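(* Let $S=(\mathsf{X},\mathcal{F})$ be a range space of VC dimension $d$, let $X\subseteq\mathsf{X}$ be a finite set, and let $\varepsilon,p,\delta>0$ be parameters. A random sample $N$ (with repetition) from $X$ of size $$O\left(\frac{1}{\varepsilon^2p}\left(d\log\frac1p+\log\frac1\delta\right)\right)$$ is a relative $(p,\varepsilon)$-approximation with probability at least $1-\delta$; that is, with probability at least $1-\delta$, for each range $\mathsf{R}\in\mathcal{F}$ simultaneously: (i) if $r(\mathsf{R})\ge p$, then $(1-\varepsilon)\,r(\mathsf{R})\le s(\mathsf{R})\le(1+\varepsilon)\,r(\mathsf{R})$; (ii) if $r(\mathsf{R})\le p$, then $s(\mathsf{R})\le(1+\varepsilon)p$.
   Context: A range space $S=(\mathsf{X},\mathcal{F})$ consists of a point set $\mathsf{X}$ and a family $\mathcal{F}$ of subsets of $\mathsf{X}$, called ranges; its VC dimension is the maximum size of a finite subset of $\mathsf{X}$ shattered by $\mathcal{F}$. A random sample with repetition from the finite set $X$ is a sequence (multiset) of independent uniformly random elements of $X$. For a range $\mathsf{R}\in\mathcal{F}$, $r(\mathsf{R})=|\mathsf{R}\cap X|/|X|$ and $s(\mathsf{R})=|\mathsf{R}\cap N|/|N|$, where elements of the sample $N$ are counted with multiplicity. The $O(\cdot)$ hides an absolute constant.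
   Formalization: Proved for ε ≤ 1 and nonempty X, with each log in the sample size read as max(1, ln); for large ε, for p near 1, or for d = 0 with δ near 1 the literal bound fails. The O-constant is stated per point type; the one for the natural numbers serves all types. *)

theory Defs
  imports "HOL-Probability.Probability"
begin

definition range_space :: "'a set \<Rightarrow> 'a set set \<Rightarrow> bool" where
  "range_space P F \<longleftrightarrow> F \<subseteq> Pow P"

definition shatters :: "'a set set \<Rightarrow> 'a set \<Rightarrow> bool" where
  "shatters F A \<longleftrightarrow> (\<lambda>R. R \<inter> A) ` F = Pow A"

(* A relation rather than a function: it is false for every d if there is no maximum, that is,
   if the VC dimension is infinite or F is empty. *)
definition has_VC_dimension :: "'a set \<Rightarrow> 'a set set \<Rightarrow> nat \<Rightarrow> bool" where
  "has_VC_dimension P F d \<longleftrightarrow>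
     (\<exists>A. finite A \<and> A \<subseteq> P \<and> shatters F A \<and> card A = d) \<and>
     (\<forall>A. finite A \<and> A \<subseteq> P \<and> shatters F A \<longrightarrow> card A \<le> d)"

definition range_measure :: "'a set \<Rightarrow> 'a set \<Rightarrow> real" where
  "range_measure X R = real (card (R \<inter> X)) / real (card X)"

(* A sample is a list, so that its elements are counted with multiplicity. *)
definition sample_measure :: "'a list \<Rightarrow> 'a set \<Rightarrow> real" where
  "sample_measure N R = real (card {i. i < length N \<and> N ! i \<in> R}) / real (length N)"

definition relative_approximation ::
  "'a set set \<Rightarrow> 'a set \<Rightarrow> real \<Rightarrow> real \<Rightarrow> 'a list \<Rightarrow> bool" where
  "relative_approximation F X p \<epsilon> N \<longleftrightarrow> (\<forall>R\<in>F.
     (range_measure X R \<ge> p \<longrightarrow>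
        (1 - \<epsilon>) * range_measure X R \<le> sample_measure N R \<and>
        sample_measure N R \<le> (1 + \<epsilon>) * range_measure X R) \<and>
     (range_measure X R \<le> p \<longrightarrow> sample_measure N R \<le> (1 + \<epsilon>) * p))"

(* The logarithm of O-bounds: the natural logarithm, but at least 1. With the plain logarithm the
   sample bound would be false when p is close to 1 (d * ln (1/p) tends to 0 for fixed d), and
   also when d = 0 and \<delta> is close to 1. For arguments \<ge> 2 the two differ by at most a constant
   factor; for arguments \<ge> exp 1 they are equal. *)
definition O_log :: "real \<Rightarrow> real" where
  "O_log x = max 1 (ln x)"

end

theory Submission
  imports Defs
begin

text \<open>
  A ghost sample of the same size replaces the true measure by an empirical one: it suffices to bound
  the probability that some range has very different numbers of hits in two halves of a sample of size
  \<open>2m\<close>. Conditionally on the \<open>2m\<close> points, random swaps between the halves turn this difference into a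
  signed sum. A union bound over all traces would cost a factor \<open>log (1/(\<epsilon>p))\<close> instead of
  \<open>log (1/p)\<close>; it is avoided by chaining. With nets at resolution \<open>p m u\<^sup>4\<close>, where \<open>u\<close> runs
  through a geometric progression in both directions from 1, a link at that level is allowed the deviation
  \<open>c \<epsilon> p m (u + u\<^sup>4)\<close>. These deviations sum to \<open>O(\<epsilon> max(p m, |T|))\<close> over all levels up to the size
  of a trace \<open>T\<close>, while the tail exponent of a link is \<open>c' \<epsilon>\<^sup>2 p m (1/u\<^sup>2 + u\<^sup>4)\<close>. The latter
  dominates the net entropy \<open>O(d log (1/(p u)))\<close> given by the Sauer-Shelah lemma and Dudley's
  packing argument, and leaves failure probabilities whose sum over the levels is \<open>O(\<delta>)\<close>.
\<close>

section \<open>Shattering and the Sauer-Shelah lemma\<close>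

lemma shatters_iff: "shatters F B \<longleftrightarrow> (\<forall>C\<subseteq>B. \<exists>R\<in>F. R \<inter> B = C)"
proof
  assume *: "shatters F B"
  show "\<forall>C\<subseteq>B. \<exists>R\<in>F. R \<inter> B = C"
  proof (intro allI impI)
    fix C assume "C \<subseteq> B"
    then have "C \<in> (\<lambda>R. R \<inter> B) ` F" using * unfolding shatters_def by blast
    then show "\<exists>R\<in>F. R \<inter> B = C" by blast
  qed
next
  assume *: "\<forall>C\<subseteq>B. \<exists>R\<in>F. R \<inter> B = C"
  have "Pow B \<subseteq> (\<lambda>R. R \<inter> B) ` F"
  proof
    fix C assume "C \<in> Pow B"
    then obtain R where "R \<in> F" "R \<inter> B = C" using * by blast
    then show "C \<in> (\<lambda>R. R \<inter> B) ` F" by blast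
  qed
  then show "shatters F B" unfolding shatters_def by (intro equalityI) auto
qed

lemma shatters_mono: "shatters F B \<Longrightarrow> F \<subseteq> G \<Longrightarrow> shatters G B"
  unfolding shatters_iff by (meson subsetD)

text \<open>Pajor's strengthening of the Sauer-Shelah lemma, by induction on the ground set.
  Deleting \<open>x\<close> merges exactly the pairs that differ only in \<open>x\<close>, so
  \<open>card F\<close> is the size of \<open>F0 \<union> F1\<close> plus that of
  \<open>F0 \<inter> F1\<close>. What the union shatters, \<open>F\<close> shatters; what the
  intersection shatters, \<open>F\<close> shatters even after \<open>x\<close> is added. The two
  kinds of shattered sets are told apart by \<open>x\<close>.\<close>

lemma card_le_card_shattered:
  assumes "finite A" "F \<subseteq> Pow A"
  shows "card F \<le> card {B. B \<subseteq> A \<and> shatters F B}"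
  using assms
proof (induction A arbitrary: F rule: finite_induct)
  case empty
  then consider "F = {}" | "F = {{}}" by (auto simp: subset_singleton_iff)
  then show ?case
  proof cases
    case 2
    then have "{B. B \<subseteq> {} \<and> shatters F B} = {{}}" by (simp add: shatters_def cong: conj_cong)
    then show ?thesis using 2 by simp
  qed simp
next
  case (insert x A)
  define F0 where "F0 = {S\<in>F. x \<notin> S}"
  define F1 where "F1 = {S. x \<notin> S \<and> insert x S \<in> F}"
  have sub: "F0 \<subseteq> Pow A" "F1 \<subseteq> Pow A"
    using insert.prems insert.hyps unfolding F0_def F1_def by auto
  have fin: "finite F0" "finite F1"
    using sub insert.hyps by (meson finite_Pow_iff finite_subset)+
  have F: "F = F0 \<union> insert x ` F1"
  proof
    show "F \<subseteq> F0 \<union> insert x ` F1"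
    proof
      fix S assume "S \<in> F"
      then show "S \<in> F0 \<union> insert x ` F1"
        by (cases "x \<in> S") (auto simp: F0_def F1_def insert_absorb intro!: image_eqI[of _ _ "S - {x}"])
    qed
  qed (auto simp: F0_def F1_def)
  have inj: "inj_on (insert x) F1"
    unfolding inj_on_def F1_def by (metis (no_types, lifting) insert_ident mem_Collect_eq)
  have "card F = card F0 + card (insert x ` F1)"
    using fin by (subst F, intro card_Un_disjoint) (auto simp: F0_def)
  also have "\<dots> = card (F0 \<union> F1) + card (F0 \<inter> F1)"
    unfolding card_image[OF inj] by (rule card_Un_Int[OF fin])
  finally have card_F: "card F = card (F0 \<union> F1) + card (F0 \<inter> F1)" .
  define S0 where "S0 = {B. B \<subseteq> A \<and> shatters (F0 \<union> F1) B}"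
  define S1 where "S1 = {B. B \<subseteq> A \<and> shatters (F0 \<inter> F1) B}"
  have fS: "finite S0" "finite S1"
    using insert.hyps unfolding S0_def S1_def by auto
  have "card F \<le> card S0 + card S1"
    unfolding card_F S0_def S1_def using sub
    by (intro add_mono insert.IH) auto
  also have "\<dots> = card (S0 \<union> insert x ` S1)"
  proof -
    have "inj_on (insert x) S1"
      unfolding inj_on_def S1_def using insert.hyps(2)
      by (metis (no_types, lifting) insert_ident mem_Collect_eq subset_iff)
    moreover have "S0 \<inter> insert x ` S1 = {}"
      using insert.hyps(2) unfolding S0_def by auto
    ultimately show ?thesis using fS by (simp add: card_Un_disjoint card_image)
  qed
  also have "\<dots> \<le> card {B. B \<subseteq> insert x A \<and> shatters F B}"
  proof (rule card_mono)
    show "finite {B. B \<subseteq> insert x A \<and> shatters F B}" using insert.hyps by simp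
    have "shatters F B" if sh: "B \<subseteq> A" "shatters (F0 \<union> F1) B" for B
      unfolding shatters_iff
    proof (intro allI impI)
      fix C assume "C \<subseteq> B"
      then obtain R where R: "R \<in> F0 \<union> F1" "R \<inter> B = C"
        using sh(2) unfolding shatters_iff by blast
      have "insert x R \<inter> B = C" using R(2) sh(1) insert.hyps(2) by blast
      then show "\<exists>R\<in>F. R \<inter> B = C" using R unfolding F0_def F1_def by blast
    qed
    moreover have "shatters F (insert x B)" if sh: "B \<subseteq> A" "shatters (F0 \<inter> F1) B" for B
      unfolding shatters_iff
    proof (intro allI impI)
      fix C assume C: "C \<subseteq> insert x B"
      then have "C - {x} \<subseteq> B" by blast
      then obtain R where R: "R \<in> F0 \<inter> F1" "R \<inter> B = C - {x}"
        using sh(2) unfolding shatters_iff by blast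
      have "x \<notin> R" "R \<in> F" "insert x R \<in> F" using R(1) unfolding F0_def F1_def by auto
      show "\<exists>R\<in>F. R \<inter> insert x B = C"
      proof (cases "x \<in> C")
        case True
        then have "insert x R \<inter> insert x B = C" using R(2) C by blast
        then show ?thesis using \<open>insert x R \<in> F\<close> by blast
      next
        case False
        then have "R \<inter> insert x B = C" using R(2) C \<open>x \<notin> R\<close> by blast
        then show ?thesis using \<open>R \<in> F\<close> by blast
      qed
    qed
    ultimately show "S0 \<union> insert x ` S1 \<subseteq> {B. B \<subseteq> insert x A \<and> shatters F B}"
      unfolding S0_def S1_def by auto
  qed
  finally show ?case .
qed

lemma card_subsets_card_le:
  assumes "finite A"
  shows "card {B. B \<subseteq> A \<and> card B \<le> d} = (\<Sum>i\<le>d. card A choose i)"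
proof -
  have "{B. B \<subseteq> A \<and> card B \<le> d} = (\<Union>i\<le>d. {B. B \<subseteq> A \<and> card B = i})" by auto
  also have "card \<dots> = (\<Sum>i\<le>d. card {B. B \<subseteq> A \<and> card B = i})"
    using assms by (intro card_UN_disjoint) auto
  finally show ?thesis using assms by (simp add: n_subsets)
qed

lemma sauer_shelah:
  assumes "finite A" and "\<And>B. B \<subseteq> A \<Longrightarrow> shatters F B \<Longrightarrow> card B \<le> d"
  shows "card ((\<lambda>R. R \<inter> A) ` F) \<le> (\<Sum>i\<le>d. card A choose i)"
proof -
  let ?G = "(\<lambda>R. R \<inter> A) ` F"
  have "shatters F B" if "B \<subseteq> A" "shatters ?G B" for B
  proof -
    have "R \<inter> A \<inter> B = R \<inter> B" for R using that(1) by blast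
    then show ?thesis using that(2) by (simp add: shatters_def image_image)
  qed
  then have "{B. B \<subseteq> A \<and> shatters ?G B} \<subseteq> {B. B \<subseteq> A \<and> card B \<le> d}"
    using assms(2) by blast
  then have "card {B. B \<subseteq> A \<and> shatters ?G B} \<le> card {B. B \<subseteq> A \<and> card B \<le> d}"
    using assms(1) by (intro card_mono) auto
  with card_le_card_shattered[OF assms(1), of ?G] show ?thesis
    unfolding card_subsets_card_le[OF assms(1)] by force
qed

lemma sum_binomial_le:
  assumes "0 < d" "d \<le> n"
  shows "(\<Sum>i\<le>d. real (n choose i)) \<le> (exp 1 * n / d) ^ d"
proof -
  \<comment> \<open>This value minimizes \<open>exp (n * x) / x ^ d\<close>, the bound to which the
    weighted binomial sum leads.\<close>
  define x where "x = real d / real n"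
  have x: "0 < x" "x \<le> 1" using assms by (auto simp: x_def)
  have "x ^ d * (\<Sum>i\<le>d. real (n choose i)) \<le> (\<Sum>i\<le>d. real (n choose i) * x ^ i)"
    unfolding sum_distrib_left using x
    by (intro sum_mono) (simp add: mult.commute[of "x ^ d"] mult_left_mono power_decreasing)
  also have "\<dots> \<le> (\<Sum>i\<le>n. real (n choose i) * x ^ i)"
    using x assms by (intro sum_mono2) auto
  also have "\<dots> = (1 + x) ^ n"
    using binomial_ring[of x 1 n] by (simp add: add.commute)
  also have "\<dots> \<le> exp x ^ n" using x by (intro power_mono) auto
  also have "\<dots> = exp 1 ^ d"
    using assms by (simp add: x_def flip: exp_of_nat_mult)
  finally have "(\<Sum>i\<le>d. real (n choose i)) \<le> exp 1 ^ d / x ^ d"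
    using x by (simp add: field_simps)
  also have "\<dots> = (exp 1 * n / d) ^ d"
    using assms by (simp add: x_def power_divide power_mult_distrib)
  finally show ?thesis .
qed

section \<open>Packing numbers\<close>

text \<open>Probabilistic method by counting: a random list of length \<open>M\<close> misses a
  given symmetric difference with probability at most \<open>(1 - \<eta>) ^ M\<close>, and there are
  at most \<open>(card \<N>)\<^sup>2\<close> ordered pairs. Hence some list meets every symmetric
  difference, and the traces on it are distinct.\<close>

lemma exists_distinguishing_list:
  fixes \<eta> :: real
  assumes Y: "finite Y" "Y \<noteq> {}" and fin: "finite \<N>" and sub: "\<N> \<subseteq> Pow Y"
    and sep: "\<And>S T. S \<in> \<N> \<Longrightarrow> T \<in> \<N> \<Longrightarrow> S \<noteq> T \<Longrightarrow> \<eta> * card Y < card (sym_diff S T)"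
    and M: "(card \<N>)\<^sup>2 * (1 - \<eta>) ^ M < 1" and \<eta>: "\<eta> \<le> 1"
  shows "\<exists>xs. set xs \<subseteq> Y \<and> length xs = M \<and> inj_on (\<lambda>S. S \<inter> set xs) \<N>"
proof -
  define \<Omega> where "\<Omega> = {xs. set xs \<subseteq> Y \<and> length xs = M}"
  define bad where "bad = (\<lambda>(S, T). {xs. set xs \<subseteq> Y - sym_diff S T \<and> length xs = M})"
  define I where "I = {(S, T). S \<in> \<N> \<and> T \<in> \<N> \<and> S \<noteq> T}"
  have I: "I \<subseteq> \<N> \<times> \<N>" by (auto simp: I_def)
  have fI: "finite I" using I fin by (meson finite_SigmaI finite_subset)
  have fbad: "finite (bad z)" for z
    using Y by (cases z) (auto simp: bad_def intro: finite_lists_length_eq)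
  have "card (bad z) \<le> ((1 - \<eta>) * card Y) ^ M" if zI: "z \<in> I" for z
  proof -
    obtain S T where z: "z = (S, T)" "S \<in> \<N>" "T \<in> \<N>" "S \<noteq> T" using zI by (auto simp: I_def)
    have D: "sym_diff S T \<subseteq> Y" using z sub by blast
    have "card (Y - sym_diff S T) = real (card Y) - card (sym_diff S T)"
      using D Y card_Diff_subset[of "sym_diff S T" Y] card_mono[OF Y(1) D]
      by (simp only: finite_subset[OF D Y(1)] of_nat_diff)
    also have "\<dots> \<le> (1 - \<eta>) * card Y" using sep[OF z(2-4)] by (simp add: algebra_simps)
    finally have "real (card (Y - sym_diff S T)) ^ M \<le> ((1 - \<eta>) * card Y) ^ M"
      by (intro power_mono) auto
    moreover have "card (bad z) = card (Y - sym_diff S T) ^ M"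
      unfolding z bad_def prod.case using Y by (intro card_lists_length_eq) auto
    ultimately show ?thesis by simp
  qed
  then have "(\<Sum>z\<in>I. real (card (bad z))) \<le> real (card I) * ((1 - \<eta>) * card Y) ^ M"
    by (rule sum_bounded_above)
  moreover have "real (card (\<Union>z\<in>I. bad z)) \<le> (\<Sum>z\<in>I. real (card (bad z)))"
    using card_UN_le[OF fI, of bad] by (simp flip: of_nat_sum)
  ultimately have "card (\<Union>z\<in>I. bad z) \<le> real (card I) * ((1 - \<eta>) * card Y) ^ M" by linarith
  also have "\<dots> \<le> (card \<N>)\<^sup>2 * ((1 - \<eta>) * card Y) ^ M"
  proof -
    have "card I \<le> (card \<N>)\<^sup>2"
      using card_mono[OF _ I] fin by (simp add: card_cartesian_product power2_eq_square)
    then show ?thesis using \<eta>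
      by (intro mult_right_mono) (auto simp flip: of_nat_power intro!: zero_le_power mult_nonneg_nonneg)
  qed
  also have "\<dots> = ((card \<N>)\<^sup>2 * (1 - \<eta>) ^ M) * card Y ^ M"
    by (simp add: power_mult_distrib)
  also have "\<dots> < 1 * real (card Y ^ M)"
    using Y M by (intro mult_strict_right_mono) (auto simp: card_gt_0_iff)
  also have "\<dots> = card \<Omega>" using Y by (simp add: \<Omega>_def card_lists_length_eq)
  finally have "card (\<Union>z\<in>I. bad z) < card \<Omega>" by (simp flip: of_nat_power)
  then have "\<not> \<Omega> \<subseteq> (\<Union>z\<in>I. bad z)"
    using fI fbad by (meson card_mono finite_UN_I not_le)
  then obtain xs where xs: "xs \<in> \<Omega>" "\<And>z. z \<in> I \<Longrightarrow> xs \<notin> bad z" by blast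
  have "inj_on (\<lambda>S. S \<inter> set xs) \<N>"
  proof (rule inj_onI, rule ccontr)
    fix S T assume *: "S \<in> \<N>" "T \<in> \<N>" "S \<inter> set xs = T \<inter> set xs" "S \<noteq> T"
    then have "set xs \<inter> sym_diff S T = {}" by blast
    then have "xs \<in> bad (S, T)" using xs(1) by (auto simp: bad_def \<Omega>_def)
    moreover have "(S, T) \<in> I" using * by (simp add: I_def)
    ultimately show False using xs(2) by blast
  qed
  then show ?thesis using xs(1) unfolding \<Omega>_def by blast
qed

text \<open>Dudley's argument: \<open>\<N>\<close> embeds into its traces on a short list, and
  Sauer-Shelah bounds the number of these. The list length is proportional to
  \<open>x = ln (card \<N>)\<close>, so the result is an inequality with \<open>x\<close> on both
  sides, in which the right-hand side depends on \<open>x\<close> only logarithmically.\<close>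

lemma ln_card_separated_le:
  fixes \<eta> :: real
  assumes Y: "finite Y" "Y \<noteq> {}" and fin: "finite \<N>" "\<N> \<noteq> {}" and sub: "\<N> \<subseteq> Pow Y"
    and sep: "\<And>S T. S \<in> \<N> \<Longrightarrow> T \<in> \<N> \<Longrightarrow> S \<noteq> T \<Longrightarrow> \<eta> * card Y < card (sym_diff S T)"
    and VC: "\<And>B. B \<subseteq> Y \<Longrightarrow> shatters \<N> B \<Longrightarrow> card B \<le> d"
    and \<eta>: "0 < \<eta>" "\<eta> \<le> 1"
  shows "ln (card \<N>) \<le> 2 * real d * ln (6 * exp 1 / \<eta>)"
proof -
  define x where "x = ln (card \<N>)"
  have k: "card \<N> \<ge> 1" using fin by (simp add: Suc_leI card_gt_0_iff)
  then have x0: "x \<ge> 0" by (simp add: x_def)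
  have expx: "exp x = card \<N>" using k by (simp add: x_def)
  have e1: "exp 1 \<ge> (2::real)" using exp_ge_add_one_self[of 1] by simp
  \<comment> \<open>The least integer above \<open>2 * x / \<eta>\<close>; the strict excess makes
    \<open>exp (2 * x - \<eta> * M)\<close> less than 1.\<close>
  define M where "M = nat \<lfloor>2 * x / \<eta>\<rfloor> + 1"
  have M: "2 * x / \<eta> < M" "M \<le> 2 * x / \<eta> + 1"
    using x0 \<eta> unfolding M_def by (auto simp: of_nat_nat) linarith+
  have "(card \<N>)\<^sup>2 * (1 - \<eta>) ^ M \<le> exp (2 * x) * exp (- \<eta>) ^ M"
    unfolding exp_double expx of_nat_power using \<eta> exp_ge_add_one_self[of "- \<eta>"]
    by (intro mult_left_mono power_mono) auto
  also have "\<dots> = exp (2 * x - \<eta> * M)"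
    by (simp add: exp_diff exp_minus exp_of_nat2_mult[symmetric] field_simps power_inverse)
  also have "\<dots> < 1" using M(1) \<eta> by (simp add: field_simps)
  finally obtain xs where xs: "set xs \<subseteq> Y" "length xs = M" "inj_on (\<lambda>S. S \<inter> set xs) \<N>"
    using exists_distinguishing_list[OF Y fin(1) sub sep] \<eta> by blast
  have "card \<N> = card ((\<lambda>S. S \<inter> set xs) ` \<N>)" using xs(3) by (simp add: card_image)
  also have "\<dots> \<le> (\<Sum>i\<le>d. card (set xs) choose i)"
    using xs(1) VC by (intro sauer_shelah) auto
  also have "\<dots> \<le> (\<Sum>i\<le>d. M choose i)"
    using card_length[of xs] xs(2) by (intro sum_mono binomial_right_mono) auto
  finally have card_le: "card \<N> \<le> (\<Sum>i\<le>d. M choose i)" .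
  have ln_ge: "ln (6 * exp 1 / \<eta>) \<ge> 1"
  proof -
    have "exp 1 \<le> 6 * exp 1 / \<eta>" using \<eta> e1 by (simp add: field_simps)
    then show ?thesis using \<eta> by (subst ln_ge_iff) auto
  qed
  show ?thesis
  \<comment> \<open>For small \<open>x\<close> the claim is immediate because the logarithm is at
    least 1. Otherwise \<open>M \<ge> d\<close>, as the binomial estimate requires, and the rounding
    of \<open>M\<close> is absorbed into \<open>3 * x / \<eta>\<close>.\<close>
  proof (cases "x \<le> 2 * d")
    case True
    then show ?thesis using mult_left_mono[OF ln_ge, of "2 * real d"] by (simp add: x_def)
  next
    case False
    have d: "d > 0" using card_le False by (cases "d = 0") (use k in \<open>auto simp: x_def\<close>)
    have x1: "x > 2 * d" "x \<ge> 2" using False d by auto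
    have "2 * x \<le> 2 * x / \<eta>" "1 \<le> x / \<eta>" using \<eta> x1 by (auto simp: field_simps)
    then have M': "d \<le> M" "M \<le> 3 * x / \<eta>" using M x1 by auto
    have "exp x \<le> (\<Sum>i\<le>d. real (M choose i))"
      unfolding expx using card_le by (simp flip: of_nat_sum)
    also have "\<dots> \<le> (exp 1 * M / d) ^ d" by (rule sum_binomial_le) (use d M' in auto)
    also have "\<dots> \<le> (6 * exp 1 / \<eta> * exp (x / (2 * d))) ^ d"
    proof (intro power_mono)
      \<comment> \<open>The denominator \<open>2 * d\<close> is chosen so that the
        \<open>d\<close>-th power contributes only \<open>exp (x / 2)\<close>, which the left-hand
        side \<open>exp x\<close> absorbs.\<close>
      have "x / (2 * d) \<le> exp (x / (2 * d))" using exp_ge_add_one_self[of "x / (2 * d)"] by linarith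
      then have "3 * x / \<eta> / d \<le> 6 / \<eta> * exp (x / (2 * d))"
        using d \<eta> by (simp add: field_simps)
      moreover have "M / d \<le> 3 * x / \<eta> / d" using M' d by (intro divide_right_mono) auto
      ultimately have "M / d \<le> 6 / \<eta> * exp (x / (2 * d))" by linarith
      from mult_left_mono[OF this, of "exp 1"]
      show "exp 1 * M / d \<le> 6 * exp 1 / \<eta> * exp (x / (2 * d))" by (simp add: mult_ac)
    qed auto
    also have "\<dots> = exp (d * ln (6 * exp 1 / \<eta>) + x / 2)"
    proof -
      have "6 * exp 1 / \<eta> * exp (x / (2 * d)) = exp (ln (6 * exp 1 / \<eta>) + x / (2 * d))"
        using \<eta> by (simp add: exp_add)
      then show ?thesis using d by (simp add: exp_of_nat_mult[symmetric] distrib_left)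
    qed
    finally have "x \<le> d * ln (6 * exp 1 / \<eta>) + x / 2" by simp
    then show ?thesis unfolding x_def by simp
  qed
qed

section \<open>Tail bounds for random signs\<close>

text \<open>Hoeffding's lemma for a fair sign: its analytic core, taken at \<open>2 * y\<close> with
  weight \<open>1 / 2\<close>, is the logarithm of this bound for \<open>y \<ge> 0\<close>, and
  \<open>cosh\<close> is even.\<close>

lemma cosh_le_exp: "cosh x \<le> exp (x\<^sup>2 / 2)" for x :: real
proof -
  have *: "cosh y \<le> exp (y\<^sup>2 / 2)" if "y \<ge> 0" for y :: real
  proof -
    have "1 + (exp (2 * y) - 1) / 2 = exp y * cosh y"
      by (simp add: cosh_field_def exp_add[symmetric] field_simps)
    then have "ln (1 + 1 / 2 * (exp (2 * y) - 1)) = y + ln (cosh y)"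
      by (simp add: ln_mult cosh_real_pos)
    with Hoeffdings_lemma_aux[of "2 * y" "1 / 2"] that
    have "ln (cosh y) \<le> y\<^sup>2 / 2" by (simp add: power_mult_distrib)
    then show ?thesis by (metis cosh_real_pos exp_le_cancel_iff exp_ln)
  qed
  show ?thesis using *[of "\<bar>x\<bar>"] by simp
qed

text \<open>A set \<open>B\<close> encodes the sign pattern that is negative on \<open>B\<close>.
  Summed over all \<open>B\<close>, the exponentials factor into one term
  \<open>2 * cosh (l * a i)\<close> per coordinate, which is independence in counting form.\<close>

lemma exp_mean_signs:
  fixes a :: "nat \<Rightarrow> real"
  shows "(\<Sum>B\<in>Pow {..<m}. exp (l * (\<Sum>i<m. (if i \<in> B then - a i else a i))))
           \<le> 2 ^ m * exp (l\<^sup>2 * (\<Sum>i<m. (a i)\<^sup>2) / 2)"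
proof -
  have "exp (l * (\<Sum>i<m. (if i \<in> B then - a i else a i)))
      = (\<Prod>i\<in>B. exp (- l * a i)) * (\<Prod>i\<in>{..<m} - B. exp (l * a i))" if "B \<in> Pow {..<m}" for B
  proof -
    have "(\<Sum>i<m. if i \<in> B then - a i else a i) = (\<Sum>i\<in>B. - a i) + (\<Sum>i\<in>{..<m} - B. a i)"
      using that by (subst sum.subset_diff[of B]) (auto simp: add.commute intro: sum.cong)
    then have "l * (\<Sum>i<m. if i \<in> B then - a i else a i)
        = (\<Sum>i\<in>B. - l * a i) + (\<Sum>i\<in>{..<m} - B. l * a i)"
      by (simp only:) (simp add: distrib_left sum_distrib_left)
    moreover have "finite B" using that by (auto intro: finite_subset)
    ultimately show ?thesis by (simp only: exp_add exp_sum finite_Diff finite_lessThan)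
  qed
  then have "(\<Sum>B\<in>Pow {..<m}. exp (l * (\<Sum>i<m. (if i \<in> B then - a i else a i))))
      = (\<Prod>i<m. exp (- l * a i) + exp (l * a i))"
    by (simp add: prod_add)
  also have "\<dots> = (\<Prod>i<m. 2 * cosh (l * a i))"
    by (intro prod.cong) (auto simp: cosh_field_def)
  also have "\<dots> \<le> (\<Prod>i<m. 2 * exp ((l * a i)\<^sup>2 / 2))"
    by (intro prod_mono) (auto intro!: cosh_le_exp)
  also have "\<dots> = 2 ^ m * exp (l\<^sup>2 * (\<Sum>i<m. (a i)\<^sup>2) / 2)"
    by (simp add: prod.distrib exp_sum[symmetric] power_mult_distrib sum_distrib_left sum_divide_distrib)
  finally show ?thesis .
qed

lemma card_signs_gt:
  fixes a :: "nat \<Rightarrow> real"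
  assumes "t > 0" "V > 0" "(\<Sum>i<m. (a i)\<^sup>2) \<le> V"
  shows "card {B \<in> Pow {..<m}. (\<Sum>i<m. (if i \<in> B then - a i else a i)) > t}
           \<le> 2 ^ m * exp (- (t\<^sup>2 / (2 * V)))"
proof -
  \<comment> \<open>The Chernoff parameter: it minimizes
    \<open>l\<^sup>2 * V / 2 - l * t\<close>.\<close>
  define l where "l = t / V"
  have l: "l > 0" using assms by (simp add: l_def)
  let ?Z = "\<lambda>B. \<Sum>i<m. (if i \<in> B then - a i else a i)"
  let ?S = "{B \<in> Pow {..<m}. ?Z B > t}"
  have "card ?S * exp (l * t) = (\<Sum>B\<in>?S. exp (l * t))" by simp
  also have "\<dots> \<le> (\<Sum>B\<in>?S. exp (l * ?Z B))"
    using l by (intro sum_mono) auto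
  also have "\<dots> \<le> (\<Sum>B\<in>Pow {..<m}. exp (l * ?Z B))"
    by (intro sum_mono2) auto
  also have "\<dots> \<le> 2 ^ m * exp (l\<^sup>2 * (\<Sum>i<m. (a i)\<^sup>2) / 2)" by (rule exp_mean_signs)
  also have "\<dots> \<le> 2 ^ m * exp (l\<^sup>2 * V / 2)"
    using assms by (intro mult_left_mono) (auto simp: mult_left_mono)
  finally have "card ?S \<le> 2 ^ m * exp (l\<^sup>2 * V / 2) * exp (- (l * t))"
    by (simp add: exp_minus field_simps)
  also have "\<dots> = 2 ^ m * exp (- (t\<^sup>2 / (2 * V)))"
  proof -
    have "l\<^sup>2 * V / 2 + - (l * t) = - (t\<^sup>2 / (2 * V))"
      using assms(2) by (simp add: l_def field_simps power2_eq_square)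
    then show ?thesis by (simp add: mult.assoc exp_add[symmetric])
  qed
  finally show ?thesis .
qed

lemma card_signs_abs_gt:
  fixes a :: "nat \<Rightarrow> real"
  assumes "t > 0" "V > 0" "(\<Sum>i<m. (a i)\<^sup>2) \<le> V"
  shows "card {B \<in> Pow {..<m}. \<bar>\<Sum>i<m. (if i \<in> B then - a i else a i)\<bar> > t}
           \<le> 2 ^ m * (2 * exp (- (t\<^sup>2 / (2 * V))))"
proof -
  let ?S = "\<lambda>a. {B \<in> Pow {..<m}. (\<Sum>i<m. (if i \<in> B then - a i else a i)) > t}"
  have eq: "- (\<Sum>i<m. (if i \<in> B then - a i else a i)) = (\<Sum>i<m. (if i \<in> B then - (- a i) else - a i))" for B
    by (simp add: sum_negf[symmetric] if_distrib cong: if_cong)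
  have "{B \<in> Pow {..<m}. \<bar>\<Sum>i<m. (if i \<in> B then - a i else a i)\<bar> > t} \<subseteq> ?S a \<union> ?S (\<lambda>i. - a i)"
    unfolding eq[symmetric] by auto
  then have "card {B \<in> Pow {..<m}. \<bar>\<Sum>i<m. (if i \<in> B then - a i else a i)\<bar> > t}
     \<le> card (?S a \<union> ?S (\<lambda>i. - a i))" by (intro card_mono) auto
  also have "\<dots> \<le> card (?S a) + card (?S (\<lambda>i. - a i))" by (rule card_Un_le)
  finally have "card {B \<in> Pow {..<m}. \<bar>\<Sum>i<m. (if i \<in> B then - a i else a i)\<bar> > t}
     \<le> real (card (?S a)) + real (card (?S (\<lambda>i. - a i)))" by linarith
  also have "\<dots> \<le> 2 ^ m * exp (- (t\<^sup>2 / (2 * V))) + 2 ^ m * exp (- (t\<^sup>2 / (2 * V)))"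
    by (intro add_mono card_signs_gt) (use assms in auto)
  finally show ?thesis by simp
qed

section \<open>Chaining\<close>

lemma card_sym_diff_triangle:
  assumes "finite A" "finite B" "finite C"
  shows "card (sym_diff A C) \<le> card (sym_diff A B) + card (sym_diff B C)"
proof -
  have "card (sym_diff A C) \<le> card (sym_diff A B \<union> sym_diff B C)"
    using assms by (intro card_mono) auto
  also have "\<dots> \<le> card (sym_diff A B) + card (sym_diff B C)" by (rule card_Un_le)
  finally show ?thesis .
qed

text \<open>A maximal separated subfamily covers, since a set far from all its members could be
  added to it.\<close>

lemma exists_net:
  fixes h :: real and \<T> :: "'a set set"
  assumes "finite \<T>" "\<And>T. T \<in> \<T> \<Longrightarrow> finite T" "h \<ge> 0"
  shows "\<exists>\<N>\<subseteq>\<T>. (\<forall>S\<in>\<N>. \<forall>T\<in>\<N>. S \<noteq> T \<longrightarrow> h < card (sym_diff S T)) \<and>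
           (\<forall>T\<in>\<T>. \<exists>S\<in>\<N>. card (sym_diff S T) \<le> h)"
proof -
  define sep where "sep = (\<lambda>\<N> :: 'a set set. \<forall>S\<in>\<N>. \<forall>T\<in>\<N>. S \<noteq> T \<longrightarrow> h < card (sym_diff S T))"
  have "finite {\<N>\<in>Pow \<T>. sep \<N>}" using assms(1) by simp
  moreover have "{} \<in> {\<N>\<in>Pow \<T>. sep \<N>}" by (simp add: sep_def)
  ultimately obtain \<N> where N: "\<N> \<subseteq> \<T>" "sep \<N>"
    and max: "\<And>\<M>. \<M> \<subseteq> \<T> \<Longrightarrow> sep \<M> \<Longrightarrow> \<N> \<subseteq> \<M> \<Longrightarrow> \<N> = \<M>"
    using finite_has_maximal2 by (smt (verit, best) PowI PowD mem_Collect_eq)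
  have "\<exists>S\<in>\<N>. card (sym_diff S T) \<le> h" if T: "T \<in> \<T>" for T
  proof (rule ccontr)
    assume far: "\<not> (\<exists>S\<in>\<N>. card (sym_diff S T) \<le> h)"
    then have "T \<notin> \<N>" using assms(3) by auto
    have "sep (insert T \<N>)"
      unfolding sep_def
    proof (intro ballI impI)
      fix S R assume SR: "S \<in> insert T \<N>" "R \<in> insert T \<N>" "S \<noteq> R"
      have *: "h < card (sym_diff Q T)" if "Q \<in> \<N>" for Q using far that by force
      have "sym_diff T R = sym_diff R T" by (rule Un_commute)
      then show "h < card (sym_diff S R)"
        using SR *[of S] *[of R] N(2) unfolding sep_def by (cases "S = T"; cases "R = T") auto
    qed
    then have "\<N> = insert T \<N>" using N T by (intro max) auto
    then show False using \<open>T \<notin> \<N>\<close> by blast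
  qed
  then show ?thesis using N unfolding sep_def by blast
qed

text \<open>The positions \<open>i\<close> and \<open>m + i\<close> are partners in the two halves
  of a sample of size \<open>2 * m\<close>; \<open>T\<close> holds the positions hit by a range and
  \<open>B\<close> the pairs that are exchanged. The value is the number of hits in the first half
  minus that in the second, after the exchange.\<close>

definition discrepancy :: "nat \<Rightarrow> nat set \<Rightarrow> nat set \<Rightarrow> real" where
  "discrepancy m B T =
     (\<Sum>i<m. if i \<in> B then - (indicator T i - indicator T (m + i)) else indicator T i - indicator T (m + i))"

lemma discrepancy_empty [simp]: "discrepancy m B {} = 0"
  by (simp add: discrepancy_def cong: if_cong)

lemma sum_indicator_two_halves:
  fixes m :: nat
  assumes "T \<subseteq> {..<2 * m}"
  shows "(\<Sum>i<m. indicator T i + indicator T (m + i)) = real (card T)"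
proof -
  have "(\<Sum>i<m. indicator T (m + i) :: real) = (\<Sum>i\<in>{m..<2 * m}. indicator T i)"
    by (rule sum.reindex_bij_witness[of _ "\<lambda>i. i - m" "\<lambda>i. m + i"]) auto
  then have "(\<Sum>i<m. indicator T i + indicator T (m + i)) = (\<Sum>i\<in>{..<m} \<union> {m..<2 * m}. indicator T i :: real)"
    by (subst sum.union_disjoint) (auto simp: sum.distrib)
  also have "{..<m} \<union> {m..<2 * m} = {..<2 * m}" by auto
  also have "(\<Sum>i<2 * m. indicator T i :: real) = card T"
    using assms by (simp add: indicator_def Int_absorb1)
  finally show ?thesis .
qed

lemma card_discrepancy_diff_gt:
  fixes t h :: real
  assumes "S \<subseteq> {..<2 * m}" "T \<subseteq> {..<2 * m}" "card (sym_diff S T) \<le> h" "h > 0" "t > 0"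
  shows "card {B \<in> Pow {..<m}. \<bar>discrepancy m B S - discrepancy m B T\<bar> > t}
           \<le> 2 ^ m * (2 * exp (- (t\<^sup>2 / (4 * h))))"
proof -
  define a :: "nat \<Rightarrow> real" where "a = (\<lambda>i. (indicator S i - indicator S (m + i)) -
    (indicator T i - indicator T (m + i)))"
  \<comment> \<open>If \<open>k\<close> of the two partners lie in the symmetric difference, then
    \<open>\<bar>a i\<bar> \<le> k \<le> 2\<close>, whence
    \<open>(a i)\<^sup>2 \<le> 2 * k\<close>.\<close>
  have "(\<Sum>i<m. (a i)\<^sup>2) \<le> (\<Sum>i<m. 2 * (indicator (sym_diff S T) i + indicator (sym_diff S T) (m + i)))"
    by (intro sum_mono) (auto simp: a_def indicator_def)
  also have "\<dots> = 2 * card (sym_diff S T)"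
    unfolding sum_distrib_left[symmetric] using assms(1,2)
    by (subst sum_indicator_two_halves) auto
  finally have "(\<Sum>i<m. (a i)\<^sup>2) \<le> 2 * h" using assms(3) by linarith
  moreover have "discrepancy m B S - discrepancy m B T = (\<Sum>i<m. if i \<in> B then - a i else a i)" for B
    unfolding discrepancy_def sum_subtractf[symmetric] by (intro sum.cong) (auto simp: a_def)
  ultimately show ?thesis
    using card_signs_abs_gt[of t "2 * h" a m] assms by simp
qed

text \<open>
  The chain of \<open>T\<close> ends at the empty set on the first level whose resolution reaches \<open>card T\<close>, so
  that the bound scales with \<open>card T\<close> and no separate peeling over the sizes of the ranges is needed.
\<close>

lemma abs_discrepancy_le_chaining:
  fixes H b t :: real and \<pi> :: "nat \<Rightarrow> nat set \<Rightarrow> nat set"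
  defines "u \<equiv> \<lambda>n. b * 2 ^ n"
  assumes fin: "\<And>T. T \<in> \<T> \<Longrightarrow> finite T"
    and \<pi>: "\<And>n T. T \<in> \<T> \<Longrightarrow> \<pi> n T \<in> \<T> \<and> card (sym_diff (\<pi> n T) T) \<le> H * u n ^ 4"
    and H: "H > 0" and b: "b > 0" "H * b ^ 4 < 1" and t: "t \<ge> 0"
    and link: "\<And>n T S. n < K \<Longrightarrow> T \<in> \<T> \<Longrightarrow> S \<in> {{}, \<pi> (Suc n) T} \<Longrightarrow>
      card (sym_diff (\<pi> n T) S) \<le> 2 * (H * u (Suc n) ^ 4) \<Longrightarrow>
      \<bar>discrepancy m B (\<pi> n T) - discrepancy m B S\<bar> \<le> t * (u (Suc n) + u (Suc n) ^ 4)"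
    and T: "T \<in> \<T>" "card T \<le> H * u K ^ 4"
  shows "H * \<bar>discrepancy m B T\<bar> \<le> 2 * t * H + 64 * t * card T"
proof -
  have u0: "u n > 0" for n using b by (simp add: u_def)
  have uS: "u (Suc n) = 2 * u n" for n by (simp add: u_def)
  have chain: "\<bar>discrepancy m B T - discrepancy m B (\<pi> n T)\<bar> \<le> 2 * t * (u n + u n ^ 4)" if "n \<le> K" for n
    using that
  proof (induction n)
    case 0
    \<comment> \<open>The resolution of level 0 is below 1, so the chain starts at \<open>T\<close>
      itself.\<close>
    have "real (card (sym_diff (\<pi> 0 T) T)) < 1" using \<pi>[OF T(1), of 0] b by (simp add: u_def)
    then have "sym_diff (\<pi> 0 T) T = {}" using \<pi>[OF T(1), of 0] fin T(1) by auto
    then have "\<pi> 0 T = T" by blast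
    then show ?case using t u0[of 0] by simp
  next
    case (Suc n)
    have "card (sym_diff (\<pi> n T) (\<pi> (Suc n) T)) \<le> card (sym_diff (\<pi> n T) T) + card (sym_diff (\<pi> (Suc n) T) T)"
      using card_sym_diff_triangle[of "\<pi> n T" T "\<pi> (Suc n) T"] \<pi>[OF T(1)] fin T(1)
      by (simp add: Un_commute)
    also have "real \<dots> \<le> H * u n ^ 4 + H * u (Suc n) ^ 4"
      using \<pi>[OF T(1), of n] \<pi>[OF T(1), of "Suc n"] by simp
    also have "\<dots> \<le> 2 * (H * u (Suc n) ^ 4)" using H u0[of n] by (simp add: uS power_mult_distrib)
    finally have "\<bar>discrepancy m B (\<pi> n T) - discrepancy m B (\<pi> (Suc n) T)\<bar>
        \<le> t * (u (Suc n) + u (Suc n) ^ 4)"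
      using Suc.prems T by (intro link) auto
    moreover have "\<bar>discrepancy m B T - discrepancy m B (\<pi> n T)\<bar> \<le> 2 * t * (u n + u n ^ 4)"
      using Suc by simp
    \<comment> \<open>The allowed deviations at least double from level to level, so their sum stays
      within twice the last one.\<close>
    moreover have "2 * t * (u n + u n ^ 4) + t * (u (Suc n) + u (Suc n) ^ 4)
        \<le> 2 * t * (u (Suc n) + u (Suc n) ^ 4)"
      using t u0[of n] by (simp add: uS power_mult_distrib algebra_simps)
    ultimately show ?case by linarith
  qed
  show ?thesis
  proof (cases "T = {}")
    case False
    then have card_T: "real (card T) \<ge> 1" using fin T by (simp add: Suc_leI card_gt_0_iff)
    define N where "N = (LEAST n. card T \<le> H * u n ^ 4)"
    have N: "card T \<le> H * u N ^ 4" "N \<le> K"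
      unfolding N_def using T(2) by (rule LeastI, rule Least_le)
    \<comment> \<open>Level 0 has resolution below 1 and \<open>T\<close> is nonempty, so there is a
      level \<open>n\<close> just below \<open>N\<close>. Its resolution is still less than
      \<open>card T\<close>, which later turns \<open>u N ^ 4 = 16 * u n ^ 4\<close> into a multiple
      of \<open>card T\<close>.\<close>
    have "N \<noteq> 0" using N(1) b card_T by (auto simp: u_def intro!: Nat.gr0I)
    then obtain n where n: "N = Suc n" using not0_implies_Suc by blast
    then have lt: "H * u n ^ 4 < card T"
      using not_less_Least[of n "\<lambda>n. card T \<le> H * u n ^ 4"] unfolding N_def by simp
    have "card (\<pi> n T) \<le> card (sym_diff (\<pi> n T) T) + card T"
      using card_sym_diff_triangle[of "\<pi> n T" T "{}"] \<pi>[OF T(1)] fin T(1) by simp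
    also have "real \<dots> \<le> H * u n ^ 4 + H * u N ^ 4"
      using \<pi>[OF T(1), of n] N by simp
    also have "\<dots> \<le> 2 * (H * u N ^ 4)" using H u0[of n] by (simp add: n uS power_mult_distrib)
    finally have "\<bar>discrepancy m B (\<pi> n T) - discrepancy m B {}\<bar> \<le> t * (u N + u N ^ 4)"
      unfolding n using N n T by (intro link) auto
    moreover have "\<bar>discrepancy m B T - discrepancy m B (\<pi> n T)\<bar> \<le> 2 * t * (u n + u n ^ 4)"
      using N n by (intro chain) auto
    ultimately have "\<bar>discrepancy m B T\<bar> \<le> 2 * t * (u n + u n ^ 4) + t * (u N + u N ^ 4)" by simp
    also have "\<dots> \<le> 2 * t * (u N + u N ^ 4)"
      using t u0[of n] by (simp add: n uS power_mult_distrib algebra_simps)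
    also have "\<dots> \<le> 2 * t * (1 + 2 * u N ^ 4)"
    proof -
      have "u N \<le> 1 + u N ^ 4"
        using u0[of N] self_le_power[of "u N" 4] by (cases "u N \<le> 1") (auto simp: add_increasing2)
      then show ?thesis using t by (intro mult_left_mono) auto
    qed
    finally have "H * \<bar>discrepancy m B T\<bar> \<le> H * (2 * t * (1 + 2 * u N ^ 4))"
      using H by (intro mult_left_mono) auto
    also have "\<dots> = 2 * t * H + 64 * t * (H * u n ^ 4)"
      by (simp add: n uS power_mult_distrib algebra_simps)
    also have "\<dots> \<le> 2 * t * H + 64 * t * card T"
      using lt t by (intro add_left_mono mult_left_mono) auto
    finally show ?thesis .
  qed (use t H in simp)
qed

section \<open>Level weights, sizes of the nets, and the union bound over all links\<close>

lemma O_log_ge: "O_log x \<ge> 1" "O_log x \<ge> ln x"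
  by (simp_all add: O_log_def)

lemma sum_level_weights_le:
  fixes b :: real
  assumes "b > 0"
  shows "(\<Sum>n<K. 1 / (1 / (b * 2 ^ n)\<^sup>2 + (b * 2 ^ n) ^ 4)) \<le> 8"
proof -
  \<comment> \<open>The summands decay geometrically on both sides of \<open>b * 2 ^ n = 1\<close>; \<open>g\<close> makes them telescope.\<close>
  define g where "g = (\<lambda>n. b * 2 ^ n / (1 + b * 2 ^ n))"
  have "1 / (1 / (b * 2 ^ n)\<^sup>2 + (b * 2 ^ n) ^ 4) \<le> 8 * (g (Suc n) - g n)" for n
  proof -
    define u where "u = b * 2 ^ n"
    have u: "u > 0" using assms by (simp add: u_def)
    have "g n = u / (1 + u)" "g (Suc n) = 2 * u / (1 + 2 * u)"
      by (simp_all add: g_def u_def mult.left_commute)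
    then have gd: "g (Suc n) - g n = u / ((1 + u) * (1 + 2 * u))"
      using u by (simp only:) (simp add: field_simps)
    have "(1 + u) * (1 + 2 * u) \<le> 8 * u * (1 / u\<^sup>2 + u ^ 4)"
    proof (cases "u \<le> 1")
      case True
      have "u * ((1 + u) * (1 + 2 * u)) \<le> 1 * ((1 + 1) * (1 + 2 * 1))"
        using u True by (intro mult_mono) auto
      also have "\<dots> \<le> 8 * (1 + u ^ 6)" using u by simp
      finally have "(1 + u) * (1 + 2 * u) \<le> 8 * (1 + u ^ 6) / u"
        using u by (simp add: pos_le_divide_eq mult.commute)
      also have "8 * (1 + u ^ 6) / u = 8 * u * (1 / u\<^sup>2 + u ^ 4)"
        using u by (simp add: field_simps eval_nat_numeral)
      finally show ?thesis .
    next
      case False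
      then have "(1 + u) * (1 + 2 * u) \<le> (2 * u) * (3 * u)" by (intro mult_mono) auto
      also have "\<dots> = 6 * u\<^sup>2" by (simp add: power2_eq_square)
      also have "\<dots> \<le> 8 * u ^ 5"
        using False power_increasing[of 2 5 u] zero_le_power2[of u] by linarith
      also have "\<dots> \<le> 8 * u * (1 / u\<^sup>2 + u ^ 4)" using u by (simp add: field_simps eval_nat_numeral)
      finally show ?thesis .
    qed
    then have "1 / (1 / u\<^sup>2 + u ^ 4) \<le> 8 * (u / ((1 + u) * (1 + 2 * u)))"
      using u by (simp add: divide_le_eq le_divide_eq add_pos_pos mult_pos_pos mult.commute mult.left_commute)
    then show ?thesis unfolding gd u_def .
  qed
  then have "(\<Sum>n<K. 1 / (1 / (b * 2 ^ n)\<^sup>2 + (b * 2 ^ n) ^ 4)) \<le> (\<Sum>n<K. 8 * (g (Suc n) - g n))"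
    by (intro sum_mono) auto
  also have "\<dots> = 8 * (g K - g 0)" by (simp only: sum_distrib_left[symmetric] sum_lessThan_telescope)
  also have "\<dots> \<le> 8"
  proof -
    have "g K \<le> 1" "g 0 \<ge> 0" using assms by (simp_all add: g_def add_pos_pos divide_le_eq)
    then show ?thesis using mult_left_mono[of "g K - g 0" 1 8] by simp
  qed
  finally show ?thesis .
qed

text \<open>Allows the entropy terms, a constant and a multiple of \<open>1 / u\<close>, to be
  absorbed into the level weight that governs the tail exponent.\<close>

lemma level_weight_ge:
  fixes u :: real
  assumes "u > 0"
  shows "1 / u\<^sup>2 + u ^ 4 \<ge> 1" "1 / u\<^sup>2 + u ^ 4 \<ge> 1 / u"
proof -
  have "1 / u\<^sup>2 + u ^ 4 \<ge> 1 \<and> 1 / u\<^sup>2 + u ^ 4 \<ge> 1 / u"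
  proof (cases "u \<le> 1")
    case True
    then have "u\<^sup>2 \<le> u" using assms by (simp add: power2_eq_square)
    then have "1 / u \<le> 1 / u\<^sup>2" "1 \<le> 1 / u"
      using assms True by (auto simp: frac_le)
    moreover have "u ^ 4 \<ge> 0" by simp
    ultimately show ?thesis by linarith
  next
    case False
    then have "u ^ 4 \<ge> 1" "1 / u \<le> 1" "1 / u\<^sup>2 \<ge> 0" by (auto simp: one_le_power)
    then show ?thesis by linarith
  qed
  then show "1 / u\<^sup>2 + u ^ 4 \<ge> 1" "1 / u\<^sup>2 + u ^ 4 \<ge> 1 / u" by auto
qed

lemma ln_card_net_le:
  fixes p u :: real and m :: nat
  assumes m: "m > 0" and sub: "\<N> \<subseteq> Pow {..<2 * m}" and ne: "\<N> \<noteq> {}"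
    and sep: "\<And>S T. S \<in> \<N> \<Longrightarrow> T \<in> \<N> \<Longrightarrow> S \<noteq> T \<Longrightarrow> p * m * u ^ 4 < card (sym_diff S T)"
    and VC: "\<And>B. B \<subseteq> {..<2 * m} \<Longrightarrow> shatters \<N> B \<Longrightarrow> card B \<le> d"
    and p: "0 < p" and u: "0 < u"
  shows "ln (card \<N>) \<le> 2 * real d * (O_log (1 / p) * (5 + 4 / u))"
proof -
  \<comment> \<open>The separation \<open>p * m * u ^ 4\<close> as a fraction of all
    \<open>2 * m\<close> positions.\<close>
  define \<eta> where "\<eta> = p * u ^ 4 / 2"
  have \<eta>: "\<eta> > 0" using p u by (simp add: \<eta>_def)
  have fin: "finite \<N>" using sub by (rule finite_subset) simp
  have sep': "\<eta> * card {..<2 * m} < card (sym_diff S T)" if "S \<in> \<N>" "T \<in> \<N>" "S \<noteq> T" for S T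
    using sep[OF that] by (simp add: \<eta>_def algebra_simps)
  show ?thesis
  proof (cases "\<eta> \<le> 1")
    case True
    have "ln (card \<N>) \<le> 2 * real d * ln (6 * exp 1 / \<eta>)"
      by (rule ln_card_separated_le[OF _ _ fin ne sub sep' VC \<eta> True])
        (use m in \<open>auto simp: lessThan_empty_iff\<close>)
    also have "\<dots> \<le> 2 * real d * (O_log (1 / p) * (5 + 4 / u))"
    proof (intro mult_left_mono)
      have "6 * exp 1 / \<eta> = 12 * exp 1 * (1 / p) * (1 / u) ^ 4"
        by (simp add: \<eta>_def power_divide)
      then have "ln (6 * exp 1 / \<eta>) = ln 12 + 1 + ln (1 / p) + 4 * ln (1 / u)"
        using p u by (simp only: ln_mult ln_realpow) (simp add: ln_mult ln_div ln_realpow)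
      also have "ln 12 \<le> (3 :: real)"
      proof -
        have "(12::real) \<le> (1 + 3 / real 12) ^ 12" by (simp add: eval_nat_numeral)
        also have "\<dots> \<le> exp 3" using exp_ge_one_plus_x_over_n_power_n[of 12 3] by simp
        finally show ?thesis by (simp add: ln_le_cancel_iff[symmetric] del: ln_le_cancel_iff)
      qed
      \<comment> \<open>A crude bound suffices: on fine levels the tail exponent grows like
        \<open>1 / u\<^sup>2\<close>.\<close>
      also have "ln (1 / u) \<le> 1 / u" using ln_le_minus_one[of "1 / u"] u by simp
      also have "ln (1 / p) \<le> O_log (1 / p)" by (rule O_log_ge)
      finally have "ln (6 * exp 1 / \<eta>) \<le> 4 + O_log (1 / p) + 4 / u" by simp
      also have "\<dots> \<le> O_log (1 / p) * (5 + 4 / u)"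
        using O_log_ge(1)[of "1 / p"] mult_right_mono[OF O_log_ge(1)[of "1 / p"], of "4 / u"] u
        by (simp add: distrib_left)
      finally show "ln (6 * exp 1 / \<eta>) \<le> O_log (1 / p) * (5 + 4 / u)" .
    qed simp
    finally show ?thesis .
  next
    case False
    \<comment> \<open>Here the required separation exceeds the number of positions, so the net has
      only one member.\<close>
    have "S = T" if "S \<in> \<N>" "T \<in> \<N>" for S T
    proof (rule ccontr)
      assume "S \<noteq> T"
      have "card (sym_diff S T) \<le> card {..<2 * m}" using that sub by (intro card_mono) auto
      also have "real \<dots> \<le> \<eta> * card {..<2 * m}" using False m by simp
      finally show False using sep'[OF that \<open>S \<noteq> T\<close>] by simp
    qed
    then have "card \<N> \<le> 1" using fin by (simp add: card_le_Suc0_iff_eq)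
    then have "card \<N> = 1" using ne fin by (simp add: le_Suc_eq)
    then have "ln (card \<N>) \<le> 0" by simp
    also have "0 \<le> 2 * real d * (O_log (1 / p) * (5 + 4 / u))"
      using O_log_ge(1)[of "1 / p"] u by simp
    finally show ?thesis .
  qed
qed

text \<open>If no link has a large deviation, chaining bounds the discrepancy of every trace at
  once. It remains to sum, over levels and links, the proportion of swaps for which a given link
  deviates.\<close>

lemma card_large_discrepancy_le:
  fixes p \<epsilon> \<delta> :: real and m :: nat
  assumes m: "m > 0" and sub: "\<T> \<subseteq> Pow {..<2 * m}"
    and VC: "\<And>B. B \<subseteq> {..<2 * m} \<Longrightarrow> shatters \<T> B \<Longrightarrow> card B \<le> d"
    and p: "0 < p" and \<epsilon>: "0 < \<epsilon>" and \<delta>: "0 < \<delta>"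
    and size: "\<epsilon>\<^sup>2 * p * m \<ge> 2 ^ 17 * (44 * real d * O_log (1 / p) + 65 * O_log (1 / \<delta>))"
  shows "card {B \<in> Pow {..<m}. \<exists>T\<in>\<T>. \<epsilon> * (card T / 2 + p * m) < \<bar>discrepancy m B T\<bar>}
           \<le> 2 ^ m * (\<delta> / 2)"
proof -
  define H where "H = p * m"
  define L where "L = O_log (1 / p)"
  define l where "l = O_log (1 / \<delta>)"
  \<comment> \<open>Fine enough that \<open>H * b ^ 4 \<le> H * b < 1\<close>.\<close>
  define b where "b = 1 / (1 + H)"
  define u where "u = (\<lambda>n. b * 2 ^ n)"
  define v where "v = (\<lambda>n. 1 / (u n)\<^sup>2 + u n ^ 4)"
  \<comment> \<open>Turns the term \<open>64 * t * card T\<close> of the chaining bound into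
    \<open>H * (\<epsilon> * (card T / 2))\<close>.\<close>
  define t where "t = \<epsilon> * H / 128"
  define \<tau> where "\<tau> = (\<lambda>n. t * (u n + u n ^ 4))"
  have H: "H > 0" using p m by (simp add: H_def)
  have t: "t > 0" using \<epsilon> H by (simp add: t_def)
  have L: "L \<ge> 1" and l: "l \<ge> 1" by (simp_all add: L_def l_def O_log_ge)
  have b: "b > 0" "H * b ^ 4 < 1"
  proof -
    show "b > 0" using H by (simp add: b_def)
    moreover have "b \<le> 1" using H by (simp add: b_def)
    ultimately have "b ^ 4 \<le> b" using power_decreasing[of 1 4 b] by simp
    then have "H * b ^ 4 \<le> H * b" using H by (intro mult_left_mono) auto
    also have "\<dots> < 1" using H by (simp add: b_def)
    finally show "H * b ^ 4 < 1" .
  qed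
  have u: "u n > 0" for n using b by (simp add: u_def)
  have uS: "u (Suc n) = 2 * u n" for n by (simp add: u_def)
  have fin: "finite \<T>" using sub by (rule finite_subset) simp
  have finT: "finite T" if "T \<in> \<T>" for T using that sub finite_subset[of T "{..<2 * m}"] by auto
  \<comment> \<open>At level \<open>K\<close> the resolution reaches \<open>2 * m\<close>, the
    largest possible size of a trace.\<close>
  obtain K where K: "(1 + 2 * m / H) / b < 2 ^ K" using real_arch_pow[of 2] by auto
  have top: "2 * m \<le> H * u K ^ 4"
  proof -
    have uK: "1 + 2 * m / H < u K" using K b by (simp add: u_def field_simps)
    moreover have "2 * m / H \<ge> 0" using H by simp
    ultimately have "u K \<le> u K ^ 4" by (intro self_le_power) auto
    then have "2 * m / H \<le> u K ^ 4" using uK by linarith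
    then show ?thesis using H by (simp add: field_simps)
  qed
  have "\<exists>\<N>\<subseteq>\<T>. (\<forall>S\<in>\<N>. \<forall>T\<in>\<N>. S \<noteq> T \<longrightarrow> H * u n ^ 4 < card (sym_diff S T)) \<and>
           (\<forall>T\<in>\<T>. \<exists>S\<in>\<N>. card (sym_diff S T) \<le> H * u n ^ 4)" for n
    using fin finT H u[of n] by (intro exists_net) auto
  then obtain net where net: "\<And>n. net n \<subseteq> \<T>"
    and sep: "\<And>n S T. S \<in> net n \<Longrightarrow> T \<in> net n \<Longrightarrow> S \<noteq> T \<Longrightarrow> H * u n ^ 4 < card (sym_diff S T)"
    and cover: "\<And>n T. T \<in> \<T> \<Longrightarrow> \<exists>S\<in>net n. card (sym_diff S T) \<le> H * u n ^ 4"
    by metis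
  define \<pi> where "\<pi> = (\<lambda>n T. SOME S. S \<in> net n \<and> card (sym_diff S T) \<le> H * u n ^ 4)"
  have \<pi>: "\<pi> n T \<in> net n \<and> card (sym_diff (\<pi> n T) T) \<le> H * u n ^ 4" if "T \<in> \<T>" for n T
    unfolding \<pi>_def by (rule someI_ex) (use cover[OF that, of n] in blast)
  have fnet: "finite (net n)" for n using net fin finite_subset by blast
  have card_net: "card (net n) \<le> exp (2 * real d * (L * (5 + 4 / u n)))" for n
  proof (cases "net n = {}")
    case False
    have "ln (card (net n)) \<le> 2 * real d * (O_log (1 / p) * (5 + 4 / u n))"
    proof (rule ln_card_net_le[OF m _ False _ _ p u])
      show "net n \<subseteq> Pow {..<2 * m}" using net sub by blast
      show "card B \<le> d" if "B \<subseteq> {..<2 * m}" "shatters (net n) B" for B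
        by (rule VC[OF that(1) shatters_mono[OF that(2) net]])
    qed (use sep in \<open>auto simp: H_def\<close>)
    moreover have "card (net n) > 0" using False fnet by (simp add: card_gt_0_iff)
    ultimately show ?thesis unfolding L_def by (metis exp_le_cancel_iff exp_ln of_nat_0_less_iff)
  qed simp
  \<comment> \<open>All pairs that can occur as a link, independently of \<open>T\<close> and
    \<open>B\<close>; the empty set is added as the end of a chain.\<close>
  define links where "links = (\<lambda>n. {(S, S') \<in> net n \<times> insert {} (net (Suc n)).
    card (sym_diff S S') \<le> 2 * (H * u (Suc n) ^ 4)})"
  define bad where "bad = (\<lambda>n (S, S'). {B \<in> Pow {..<m}.
    \<tau> (Suc n) < \<bar>discrepancy m B S - discrepancy m B S'\<bar>})"
  have flinks: "finite (links n)" for n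
    unfolding links_def using fnet by (auto intro: finite_subset[of _ "net n \<times> insert {} (net (Suc n))"])
  have v1: "v n \<ge> 1" "v n \<ge> 1 / u n" for n unfolding v_def using level_weight_ge[OF u[of n]] by auto
  have card_links: "card (links n) \<le> 2 * exp (44 * real d * L * v (Suc n))" for n
  proof -
    have "card (links n) \<le> card (net n \<times> insert {} (net (Suc n)))"
      unfolding links_def using fnet by (intro card_mono) auto
    also have "\<dots> \<le> card (net n) * (card (net (Suc n)) + 1)"
      using fnet by (simp add: card_cartesian_product card_insert_if)
    also have "real \<dots> \<le> exp (2 * real d * (L * (5 + 4 / u n))) * (2 * exp (2 * real d * (L * (5 + 4 / u (Suc n)))))"
    proof -
      have "1 \<le> exp (2 * real d * (L * (5 + 4 / u (Suc n))))" using L u[of "Suc n"] by simp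
      then have "real (card (net (Suc n)) + 1) \<le> 2 * exp (2 * real d * (L * (5 + 4 / u (Suc n))))"
        using card_net[of "Suc n"] unfolding of_nat_add of_nat_1 by linarith
      then show ?thesis unfolding of_nat_mult using card_net[of n] by (intro mult_mono) auto
    qed
    \<comment> \<open>Since \<open>u (Suc n) = 2 * u n\<close>, the terms \<open>4 / u n\<close> and
      \<open>4 / u (Suc n)\<close> add up to \<open>12 / u (Suc n)\<close>.\<close>
    also have "\<dots> = 2 * exp (2 * real d * L * (10 + 12 * (1 / u (Suc n))))"
      by (simp add: exp_add[symmetric] uS algebra_simps)
    also have "\<dots> \<le> 2 * exp (2 * real d * L * (22 * v (Suc n)))"
      using v1[of "Suc n"] L by (intro mult_left_mono iffD2[OF exp_le_cancel_iff]) auto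
    finally show ?thesis by (simp add: mult_ac)
  qed
  have card_bad: "card (bad n z) \<le> 2 ^ m * (2 * exp (- ((44 * real d * L + 65 * l) * v (Suc n))))"
    if z: "z \<in> links n" for n z
  proof -
    obtain S S' where S: "z = (S, S')" "S \<subseteq> {..<2 * m}" "S' \<subseteq> {..<2 * m}"
      "card (sym_diff S S') \<le> 2 * (H * u (Suc n) ^ 4)"
      using z net sub unfolding links_def by blast
    define w where "w = u (Suc n)"
    have w: "w > 0" by (simp add: w_def u)
    have "card (bad n z) \<le> 2 ^ m * (2 * exp (- ((\<tau> (Suc n))\<^sup>2 / (4 * (2 * (H * w ^ 4))))))"
      unfolding S(1) bad_def prod.case using S H w t
      by (intro card_discrepancy_diff_gt) (auto simp: \<tau>_def w_def[symmetric] add_pos_pos)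
    also have "\<dots> \<le> 2 ^ m * (2 * exp (- ((44 * real d * L + 65 * l) * v (Suc n))))"
    proof -
      \<comment> \<open>The factor \<open>2 ^ 17\<close> is \<open>128\<^sup>2 * 8\<close>: the
        square of the denominator of \<open>t\<close>, times the 8 of the tail exponent. Dropping
        the cross term of \<open>(w + w ^ 4)\<^sup>2\<close> leaves the level weight.\<close>
      have "(44 * real d * L + 65 * l) * v (Suc n) \<le> (\<epsilon>\<^sup>2 * H / 2 ^ 17) * v (Suc n)"
        using size v1(1)[of "Suc n"] by (intro mult_right_mono) (simp_all add: H_def L_def l_def)
      also have "\<dots> \<le> (\<epsilon>\<^sup>2 * H / 2 ^ 17) * ((w + w ^ 4)\<^sup>2 / w ^ 4)"
      proof (intro mult_left_mono)
        have "(w + w ^ 4)\<^sup>2 / w ^ 4 = 1 / w\<^sup>2 + 2 * w + w ^ 4"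
          using w by (simp add: field_simps power2_eq_square eval_nat_numeral)
        then show "v (Suc n) \<le> (w + w ^ 4)\<^sup>2 / w ^ 4" using w by (simp add: v_def w_def)
      qed (use H in auto)
      also have "\<dots> = (\<tau> (Suc n))\<^sup>2 / (4 * (2 * (H * w ^ 4)))"
        using H w by (simp add: \<tau>_def t_def w_def[symmetric] power2_eq_square field_simps)
      finally show ?thesis by simp
    qed
    finally show ?thesis .
  qed
  have "{B \<in> Pow {..<m}. \<exists>T\<in>\<T>. \<epsilon> * (card T / 2 + p * m) < \<bar>discrepancy m B T\<bar>}
      \<subseteq> (\<Union>n<K. \<Union>z\<in>links n. bad n z)"
  proof (rule subsetI, rule ccontr)
    fix B assume B: "B \<in> {B \<in> Pow {..<m}. \<exists>T\<in>\<T>. \<epsilon> * (card T / 2 + p * m) < \<bar>discrepancy m B T\<bar>}"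
      and nbad: "B \<notin> (\<Union>n<K. \<Union>z\<in>links n. bad n z)"
    then obtain T where T: "T \<in> \<T>" "\<epsilon> * (card T / 2 + p * m) < \<bar>discrepancy m B T\<bar>" by blast
    have "H * \<bar>discrepancy m B T\<bar> \<le> 2 * t * H + 64 * t * card T"
    proof (rule abs_discrepancy_le_chaining[where \<T> = \<T> and \<pi> = \<pi> and b = b and K = K])
      show "\<pi> n T \<in> \<T> \<and> card (sym_diff (\<pi> n T) T) \<le> H * (b * 2 ^ n) ^ 4" if "T \<in> \<T>" for n T
        using \<pi>[OF that, of n] net[of n] by (auto simp: u_def)
      show "\<bar>discrepancy m B (\<pi> n T) - discrepancy m B S\<bar> \<le> t * (b * 2 ^ Suc n + (b * 2 ^ Suc n) ^ 4)"
        if "n < K" "T \<in> \<T>" "S \<in> {{}, \<pi> (Suc n) T}"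
          "card (sym_diff (\<pi> n T) S) \<le> 2 * (H * (b * 2 ^ Suc n) ^ 4)" for n T S
      proof -
        have "(\<pi> n T, S) \<in> links n"
          using that \<pi>[OF that(2)] by (auto simp: links_def u_def)
        then have "B \<notin> bad n (\<pi> n T, S)" using nbad that(1) by blast
        then show ?thesis using B by (simp add: bad_def \<tau>_def u_def)
      qed
      have "card T \<le> card {..<2 * m}" using T sub by (intro card_mono) auto
      then show "card T \<le> H * (b * 2 ^ K) ^ 4" using top by (simp add: u_def)
    qed (use finT H b t T in auto)
    also have "\<dots> = H * (\<epsilon> * (card T / 2 + H / 64))" by (simp add: t_def algebra_simps)
    also have "\<dots> \<le> H * (\<epsilon> * (card T / 2 + H))"
      using H \<epsilon> by (intro mult_left_mono add_left_mono) auto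
    finally have "\<bar>discrepancy m B T\<bar> \<le> \<epsilon> * (card T / 2 + H)" using H by simp
    then show False using T(2) by (simp add: H_def)
  qed
  then have "card {B \<in> Pow {..<m}. \<exists>T\<in>\<T>. \<epsilon> * (card T / 2 + p * m) < \<bar>discrepancy m B T\<bar>}
      \<le> card (\<Union>n<K. \<Union>z\<in>links n. bad n z)"
    using flinks by (intro card_mono) (auto simp: bad_def)
  also have "\<dots> \<le> (\<Sum>n<K. card (\<Union>z\<in>links n. bad n z))" by (rule card_UN_le) simp
  also have "\<dots> \<le> (\<Sum>n<K. \<Sum>z\<in>links n. card (bad n z))" by (intro sum_mono card_UN_le flinks)
  also have "real \<dots> \<le> (\<Sum>n<K. 2 ^ m * (\<delta> / 16 * (1 / v (Suc n))))"
    unfolding of_nat_sum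
  proof (intro sum_mono)
    fix n
    have "(\<Sum>z\<in>links n. real (card (bad n z)))
        \<le> card (links n) * (2 ^ m * (2 * exp (- ((44 * real d * L + 65 * l) * v (Suc n)))))"
      using card_bad by (rule sum_bounded_above)
    also have "\<dots> \<le> 2 * exp (44 * real d * L * v (Suc n)) * (2 ^ m * (2 * exp (- ((44 * real d * L + 65 * l) * v (Suc n)))))"
      using card_links[of n] by (intro mult_right_mono) auto
    \<comment> \<open>The part \<open>44 * d * L\<close> of the exponent cancels the number of links
      exactly.\<close>
    also have "\<dots> = 2 ^ m * (4 * exp (- (65 * l * v (Suc n))))"
      by (simp add: exp_add[symmetric] algebra_simps)
    also have "\<dots> \<le> 2 ^ m * (4 * (\<delta> * (1 / (64 * v (Suc n)))))"
    proof -
      \<comment> \<open>As \<open>l\<close> and \<open>v\<close> are at least 1, the exponent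
        splits: \<open>exp (- l)\<close> pays for \<open>\<delta>\<close>, and
        \<open>exp (- (64 * v))\<close> for a factor \<open>1 / (64 * v)\<close> that is summable
        over the levels.\<close>
      have "l + 64 * v (Suc n) \<le> l * v (Suc n) + 64 * (l * v (Suc n))"
        using l v1(1)[of "Suc n"] mult_left_mono[of 1 "v (Suc n)" l] mult_right_mono[of 1 l "v (Suc n)"]
        by (intro add_mono) auto
      then have "exp (- (65 * l * v (Suc n))) \<le> exp (- l) * exp (- (64 * v (Suc n)))"
        by (simp add: exp_add[symmetric])
      also have "\<dots> \<le> \<delta> * (1 / (64 * v (Suc n)))"
      proof (intro mult_mono)
        have "- l \<le> ln \<delta>" using O_log_ge(2)[of "1 / \<delta>"] \<delta> by (simp add: l_def ln_div)
        then show "exp (- l) \<le> \<delta>" using \<delta> by (simp add: ln_ge_iff)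
        have "64 * v (Suc n) \<le> exp (64 * v (Suc n))" using exp_ge_add_one_self[of "64 * v (Suc n)"] by linarith
        then show "exp (- (64 * v (Suc n))) \<le> 1 / (64 * v (Suc n))"
          using v1(1)[of "Suc n"] by (simp add: exp_minus field_simps)
      qed (use \<delta> in auto)
      finally show ?thesis by (rule mult_left_mono[OF mult_left_mono]) simp_all
    qed
    also have "\<dots> = 2 ^ m * (\<delta> / 16 * (1 / v (Suc n)))" by simp
    finally show "(\<Sum>z\<in>links n. real (card (bad n z))) \<le> 2 ^ m * (\<delta> / 16 * (1 / v (Suc n)))" .
  qed
  also have "\<dots> = 2 ^ m * (\<delta> / 16 * (\<Sum>n<K. 1 / v (Suc n)))"
    by (simp only: sum_distrib_left)
  also have "\<dots> \<le> 2 ^ m * (\<delta> / 16 * 8)"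
    using sum_level_weights_le[of "2 * b" K] b \<delta>
    by (intro mult_left_mono) (auto simp: v_def u_def mult_ac)
  finally show ?thesis by simp
qed

section \<open>Uniform samples\<close>

definition samples :: "nat \<Rightarrow> 'a set \<Rightarrow> 'a list set" where
  "samples m X = {xs. set xs \<subseteq> X \<and> length xs = m}"

lemma samples_0 [simp]: "samples 0 X = {[]}"
  by (auto simp: samples_def)

lemma finite_samples [intro, simp]: "finite X \<Longrightarrow> finite (samples m X)"
  unfolding samples_def by (rule finite_lists_length_eq)

lemma card_samples: "finite X \<Longrightarrow> card (samples m X) = card X ^ m"
  unfolding samples_def by (rule card_lists_length_eq)

lemma samples_nonempty: "finite X \<Longrightarrow> X \<noteq> {} \<Longrightarrow> samples m X \<noteq> {}"
  using card_samples[of X m] by (metis card.empty card_0_eq power_not_zero)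

lemma samples_Suc: "samples (Suc m) X = (\<lambda>(x, xs). x # xs) ` (X \<times> samples m X)"
  unfolding samples_def by (auto simp: length_Suc_conv)

lemma sum_samples_Suc:
  "(\<Sum>xs\<in>samples (Suc m) X. f xs) = (\<Sum>x\<in>X. \<Sum>xs\<in>samples m X. f (x # xs))"
  unfolding samples_Suc sum.cartesian_product
  by (subst sum.reindex) (auto simp: inj_on_def case_prod_unfold)

text \<open>Turns the probability in the theorem into a proportion of lists, so that all other
  arguments can count.\<close>

lemma replicate_pmf_of_set:
  assumes X: "finite X" "X \<noteq> {}"
  shows "replicate_pmf m (pmf_of_set X) = pmf_of_set (samples m X)"
proof (induction m)
  case (Suc m)
  have "replicate_pmf (Suc m) (pmf_of_set X)
      = map_pmf (\<lambda>(x, xs). x # xs) (pair_pmf (pmf_of_set X) (pmf_of_set (samples m X)))"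
    by (simp add: Suc pair_pmf_def map_pmf_def bind_assoc_pmf bind_return_pmf)
  also have "pair_pmf (pmf_of_set X) (pmf_of_set (samples m X)) = pmf_of_set (X \<times> samples m X)"
  proof (rule pmf_eqI)
    fix z
    show "pmf (pair_pmf (pmf_of_set X) (pmf_of_set (samples m X))) z = pmf (pmf_of_set (X \<times> samples m X)) z"
      using X samples_nonempty[OF X, of m]
      by (cases z) (simp add: pmf_pair card_cartesian_product indicator_def)
  qed
  also have "map_pmf (\<lambda>(x, xs). x # xs) \<dots> = pmf_of_set (samples (Suc m) X)"
    unfolding samples_Suc using X samples_nonempty[OF X, of m]
    by (intro map_pmf_of_set_inj) (auto simp: inj_on_def)
  finally show ?case .
qed (simp add: pmf_of_set_singleton)

lemma sum_samples_sum_list: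
  fixes g :: "'a \<Rightarrow> real"
  assumes "sum g X = 0"
  shows "(\<Sum>xs\<in>samples m X. sum_list (map g xs)) = 0"
proof (induction m)
  case (Suc m)
  then show ?case
    by (simp add: sum_samples_Suc sum.distrib sum_distrib_left[symmetric] assms)
qed simp

text \<open>Variances of independent centred variables add up: the cross terms vanish. The factor
  \<open>card X\<close> on the left avoids the exponent \<open>m - 1\<close>.\<close>

lemma sum_samples_sum_list_squared:
  fixes g :: "'a \<Rightarrow> real"
  assumes X: "finite X" and g: "sum g X = 0"
  shows "card X * (\<Sum>xs\<in>samples m X. (sum_list (map g xs))\<^sup>2) = m * card X ^ m * (\<Sum>x\<in>X. (g x)\<^sup>2)"
proof (induction m)
  case (Suc m)
  have "(\<Sum>xs\<in>samples (Suc m) X. (sum_list (map g xs))\<^sup>2)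
     = card (samples m X) * (\<Sum>x\<in>X. (g x)\<^sup>2) + card X * (\<Sum>xs\<in>samples m X. (sum_list (map g xs))\<^sup>2)
       + (\<Sum>x\<in>X. 2 * g x * (\<Sum>xs\<in>samples m X. sum_list (map g xs)))"
    by (simp add: sum_samples_Suc power2_sum sum.distrib sum_distrib_left)
  also have "\<dots> = card X ^ m * (\<Sum>x\<in>X. (g x)\<^sup>2) + m * card X ^ m * (\<Sum>x\<in>X. (g x)\<^sup>2)"
    by (simp add: sum_samples_sum_list[OF g] card_samples[OF X] Suc)
  finally show ?case by (simp add: algebra_simps)
qed simp

definition hits :: "'a set \<Rightarrow> 'a list \<Rightarrow> nat" where
  "hits R N = card {i. i < length N \<and> N ! i \<in> R}"

lemma sample_measure_eq_hits: "sample_measure N R = hits R N / length N"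
  by (simp add: sample_measure_def hits_def)

lemma hits_eq_sum: "real (hits R N) = (\<Sum>i<length N. indicator R (N ! i))"
  by (simp add: hits_def indicator_def Collect_conj_eq lessThan_def[symmetric])

lemma hits_eq_sum_list: "real (hits R N) = sum_list (map (indicator R) N)"
  by (simp add: hits_eq_sum sum_list_sum_nth lessThan_atLeast0)

lemma sum_samples_hits_deviation:
  assumes X: "finite X" "X \<noteq> {}"
  shows "(\<Sum>N\<in>samples m X. (hits R N - m * range_measure X R)\<^sup>2) \<le> m * card X ^ m * range_measure X R"
proof -
  define r where "r = range_measure X R"
  define g :: "'a \<Rightarrow> real" where "g = (\<lambda>x. indicator R x - r)"
  have cX: "real (card X) > 0" using X by (simp add: card_gt_0_iff)
  have ind: "(\<Sum>x\<in>X. indicator R x) = card X * r"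
    using X by (simp add: r_def range_measure_def indicator_def Int_commute)
  have g0: "sum g X = 0" by (simp add: g_def sum_subtractf ind)
  have r0: "r \<ge> 0" by (simp add: r_def range_measure_def)
  have "(\<Sum>x\<in>X. (g x)\<^sup>2) = (\<Sum>x\<in>X. indicator R x - 2 * r * indicator R x + r\<^sup>2)"
    by (intro sum.cong refl) (auto simp: g_def indicator_def power2_eq_square algebra_simps)
  also have "\<dots> = card X * r - 2 * r * (card X * r) + card X * r\<^sup>2"
    by (simp add: sum.distrib sum_subtractf ind sum_distrib_left[symmetric])
  \<comment> \<open>The variance of an indicator, \<open>r - r\<^sup>2\<close>, is bounded by its
    mean.\<close>
  also have "\<dots> \<le> card X * r"
    using r0 by (simp add: power2_eq_square algebra_simps mult_nonneg_nonneg)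
  finally have sq: "(\<Sum>x\<in>X. (g x)\<^sup>2) \<le> card X * r" .
  have "sum_list (map g N) = hits R N - m * r" if "N \<in> samples m X" for N
  proof -
    have "sum_list (map g N) = sum_list (map (indicator R) N) - length N * r"
      by (induction N) (simp_all add: g_def algebra_simps)
    then show ?thesis using that by (simp add: hits_eq_sum_list samples_def)
  qed
  then have "card X * (\<Sum>N\<in>samples m X. (hits R N - m * r)\<^sup>2) = m * card X ^ m * (\<Sum>x\<in>X. (g x)\<^sup>2)"
    using sum_samples_sum_list_squared[OF X(1) g0, of m] by simp
  also have "\<dots> \<le> m * card X ^ m * (card X * r)" using sq by (intro mult_left_mono) auto
  finally have "card X * (\<Sum>N\<in>samples m X. (hits R N - m * r)\<^sup>2) \<le> card X * (m * card X ^ m * r)"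
    by (simp add: mult_ac)
  then show ?thesis using cX by (simp add: r_def)
qed

text \<open>Chebyshev's inequality: the variance is at most \<open>m * max r p\<close>, and the 32
  in the size condition is \<open>4\<^sup>2 * 2\<close>, for the deviation
  \<open>\<epsilon> / 4\<close> and the failure probability \<open>1 / 2\<close>.\<close>

lemma card_ghost_samples_ge:
  fixes p \<epsilon> r :: real
  assumes X: "finite X" "X \<noteq> {}" and p: "p > 0" and \<epsilon>: "\<epsilon> > 0"
    and size: "\<epsilon>\<^sup>2 * p * m \<ge> 32" and r: "r = range_measure X R"
  shows "card {N \<in> samples m X. \<bar>hits R N - m * r\<bar> \<le> m * (\<epsilon> / 4 * max r p)} \<ge> card (samples m X) / 2"
proof -
  define M where "M = max r p"
  define bad where "bad = {N \<in> samples m X. \<not> \<bar>hits R N - m * r\<bar> \<le> m * (\<epsilon> / 4 * M)}"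
  define c where "c = real m * (\<epsilon> / 4 * M)"
  have m: "real m > 0" using size by (cases "m = 0") auto
  have M: "M > 0" "M \<ge> r" "M \<ge> p" using p by (auto simp: M_def)
  have c: "c > 0" using m M \<epsilon> by (simp add: c_def)
  have "card bad * c\<^sup>2 = (\<Sum>N\<in>bad. c\<^sup>2)" by simp
  also have "\<dots> \<le> (\<Sum>N\<in>bad. (hits R N - m * r)\<^sup>2)"
  proof (intro sum_mono)
    fix N assume "N \<in> bad"
    then have "\<bar>c\<bar> \<le> \<bar>hits R N - m * r\<bar>" using c by (simp add: bad_def c_def)
    then show "c\<^sup>2 \<le> (hits R N - m * r)\<^sup>2" by (rule abs_le_square_iff[THEN iffD1])
  qed
  also have "\<dots> \<le> (\<Sum>N\<in>samples m X. (hits R N - m * r)\<^sup>2)"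
    using X by (intro sum_mono2) (auto simp: bad_def)
  also have "\<dots> \<le> m * card X ^ m * r" unfolding r by (rule sum_samples_hits_deviation[OF X])
  also have "\<dots> \<le> m * card X ^ m * M" using M by (intro mult_left_mono) auto
  also have "\<dots> \<le> (card X ^ m / 2) * c\<^sup>2"
  proof -
    have "32 \<le> \<epsilon>\<^sup>2 * M * m"
      using size M mult_right_mono[of p M "\<epsilon>\<^sup>2 * m"] by (simp add: mult_ac)
    then have "m * M * 32 \<le> m * M * (\<epsilon>\<^sup>2 * M * m)" using m M by (intro mult_left_mono) auto
    then have "m * M \<le> c\<^sup>2 / 2" by (simp add: c_def power2_eq_square algebra_simps)
    then have "card X ^ m * (m * M) \<le> card X ^ m * (c\<^sup>2 / 2)" by (intro mult_left_mono) auto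
    then show ?thesis by (simp add: mult_ac)
  qed
  finally have "card bad \<le> card X ^ m / 2" using c by simp
  moreover have "real (card X ^ m) = card (samples m X)" using X by (simp add: card_samples)
  moreover have "card (samples m X) = card {N \<in> samples m X. \<bar>hits R N - m * r\<bar> \<le> m * (\<epsilon> / 4 * M)} + card bad"
    unfolding bad_def using X by (subst card_Un_disjoint[symmetric]) (auto intro: arg_cong[of _ _ card])
  ultimately show ?thesis unfolding M_def by linarith
qed

section \<open>Symmetrization\<close>

definition swap :: "nat set \<Rightarrow> 'a list \<times> 'a list \<Rightarrow> 'a list \<times> 'a list" where
  "swap B = (\<lambda>(N, N').
     (map (\<lambda>i. if i \<in> B then N' ! i else N ! i) [0..<length N],
      map (\<lambda>i. if i \<in> B then N ! i else N' ! i) [0..<length N]))"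

text \<open>Each swap is its own inverse, so it preserves the uniform distribution on pairs of
  samples.\<close>

lemma bij_betw_swap: "bij_betw (swap B) (samples m X \<times> samples m X) (samples m X \<times> samples m X)"
proof (rule bij_betwI[where g = "swap B"])
  show "swap B \<in> samples m X \<times> samples m X \<rightarrow> samples m X \<times> samples m X"
    by (auto simp: swap_def samples_def) (metis nth_mem subsetD)+
  then show "swap B \<in> samples m X \<times> samples m X \<rightarrow> samples m X \<times> samples m X" .
qed (auto simp: swap_def samples_def intro!: nth_equalityI)

text \<open>Recording positions instead of points keeps multiplicities and makes every trace a
  subset of a fixed index set.\<close>

definition hit_positions :: "'a list \<Rightarrow> 'a set \<Rightarrow> nat set" where
  "hit_positions W R = {j. j < length W \<and> W ! j \<in> R}"

lemma card_hit_positions: "card (hit_positions W R) = hits R W"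
  by (simp add: hit_positions_def hits_def)

lemma hits_append: "hits R (N @ N') = hits R N + hits R N'"
proof -
  have "real (hits R (N @ N')) = real (hits R N) + real (hits R N')"
    by (simp add: hits_eq_sum_list)
  then show ?thesis by linarith
qed

lemma discrepancy_hit_positions:
  assumes "N \<in> samples m X" "N' \<in> samples m X"
  shows "discrepancy m B (hit_positions (N @ N') R) =
    real (hits R (fst (swap B (N, N')))) - real (hits R (snd (swap B (N, N'))))"
proof -
  have [simp]: "length N = m" "length N' = m" using assms by (auto simp: samples_def)
  have "discrepancy m B (hit_positions (N @ N') R)
     = (\<Sum>i<m. indicator R (if i \<in> B then N' ! i else N ! i) - indicator R (if i \<in> B then N ! i else N' ! i))"
    unfolding discrepancy_def by (intro sum.cong) (auto simp: hit_positions_def indicator_def nth_append)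
  then show ?thesis by (simp add: hits_eq_sum swap_def sum_subtractf cong: sum.cong_simp if_cong)
qed

lemma hits_swap:
  assumes "N \<in> samples m X" "N' \<in> samples m X"
  shows "hits R (fst (swap B (N, N'))) + hits R (snd (swap B (N, N'))) = hits R N + hits R N'"
proof -
  have [simp]: "length N = m" "length N' = m" using assms by (auto simp: samples_def)
  have "real (hits R (fst (swap B (N, N')))) + real (hits R (snd (swap B (N, N')))) = real (hits R N) + real (hits R N')"
    unfolding hits_eq_sum by (auto simp: swap_def sum.distrib[symmetric] intro!: sum.cong)
  then show ?thesis by linarith
qed

text \<open>A range cannot separate two positions that carry the same point, so a shattered set of
  positions carries distinct points, and these points are shattered by \<open>F\<close>.\<close>

lemma card_shattered_hit_positions_le:
  assumes VC: "\<And>A. finite A \<Longrightarrow> A \<subseteq> P \<Longrightarrow> shatters F A \<Longrightarrow> card A \<le> d"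
    and W: "set W \<subseteq> P" and B: "B \<subseteq> {..<length W}" "shatters (hit_positions W ` F) B"
  shows "card B \<le> d"
proof -
  have ex: "\<exists>R\<in>F. hit_positions W R \<inter> B = C" if "C \<subseteq> B" for C
    using B(2) that unfolding shatters_iff by blast
  have mem: "j \<in> hit_positions W R \<longleftrightarrow> W ! j \<in> R" if "j \<in> B" for j R
    using that B(1) by (auto simp: hit_positions_def)
  have inj: "inj_on ((!) W) B"
  proof (rule inj_onI, rule ccontr)
    fix j k assume jk: "j \<in> B" "k \<in> B" "W ! j = W ! k" "j \<noteq> k"
    obtain R where "R \<in> F" "hit_positions W R \<inter> B = {j}" using ex[of "{j}"] jk by blast
    then have "j \<in> hit_positions W R" "k \<notin> hit_positions W R" using jk by auto
    then show False using mem jk by metis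
  qed
  have "shatters F ((!) W ` B)"
    unfolding shatters_iff
  proof (intro allI impI)
    fix D assume D: "D \<subseteq> (!) W ` B"
    obtain R where R: "R \<in> F" "hit_positions W R \<inter> B = {j\<in>B. W ! j \<in> D}" using ex[of "{j\<in>B. W ! j \<in> D}"] by blast
    then have "W ! j \<in> R \<longleftrightarrow> W ! j \<in> D" if "j \<in> B" for j using mem[OF that] that by blast
    then have "R \<inter> (!) W ` B = D" using D by auto
    then show "\<exists>R\<in>F. R \<inter> (!) W ` B = D" using R(1) by blast
  qed
  moreover have "finite ((!) W ` B)" "(!) W ` B \<subseteq> P"
    using B(1) W by (auto intro: finite_subset subsetD[OF W nth_mem])
  ultimately have "card ((!) W ` B) \<le> d" by (intro VC)
  then show ?thesis using inj by (simp add: card_image)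
qed

text \<open>The threshold depends on the two samples only through their total number of hits, which
  swapping leaves unchanged.\<close>

definition deviating_pairs :: "'a set set \<Rightarrow> 'a set \<Rightarrow> nat \<Rightarrow> real \<Rightarrow> real \<Rightarrow> ('a list \<times> 'a list) set" where
  "deviating_pairs F X m p \<epsilon> = {(N, N') \<in> samples m X \<times> samples m X.
     \<exists>R\<in>F. \<epsilon> * ((real (hits R N) + real (hits R N')) / 2 + p * m) < \<bar>real (hits R N) - real (hits R N')\<bar>}"

text \<open>Double counting of pairs of samples and swaps: every swap permutes the pairs, while for
  each fixed pair at most a fraction \<open>\<delta> / 2\<close> of the swaps makes it
  deviating.\<close>

lemma card_deviating_pairs_le:
  fixes p \<epsilon> \<delta> :: real
  assumes X: "finite X" "X \<subseteq> P" and m: "m > 0"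
    and VC: "\<And>A. finite A \<Longrightarrow> A \<subseteq> P \<Longrightarrow> shatters F A \<Longrightarrow> card A \<le> d"
    and p: "0 < p" and \<epsilon>: "0 < \<epsilon>" and \<delta>: "0 < \<delta>"
    and size: "\<epsilon>\<^sup>2 * p * m \<ge> 2 ^ 17 * (44 * real d * O_log (1 / p) + 65 * O_log (1 / \<delta>))"
  shows "card (deviating_pairs F X m p \<epsilon>) \<le> (card (samples m X))\<^sup>2 * (\<delta> / 2)"
proof -
  define \<Omega> where "\<Omega> = samples m X \<times> samples m X"
  define E where "E = deviating_pairs F X m p \<epsilon>"
  have f\<Omega>: "finite \<Omega>" using X by (simp add: \<Omega>_def)
  have E: "E \<subseteq> \<Omega>" by (auto simp: E_def \<Omega>_def deviating_pairs_def)
  have swaps: "card {B \<in> Pow {..<m}. swap B \<omega> \<in> E} \<le> 2 ^ m * (\<delta> / 2)" if \<omega>: "\<omega> \<in> \<Omega>" for \<omega>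
  proof -
    obtain N N' where N: "\<omega> = (N, N')" "N \<in> samples m X" "N' \<in> samples m X"
      using \<omega> by (auto simp: \<Omega>_def)
    have W: "set (N @ N') \<subseteq> P" "length (N @ N') = 2 * m"
      using N X by (auto simp: samples_def)
    have "(swap B \<omega> \<in> E) = (\<exists>T\<in>hit_positions (N @ N') ` F. \<epsilon> * (card T / 2 + p * m) < \<bar>discrepancy m B T\<bar>)" for B
    proof -
      have "swap B \<omega> \<in> \<Omega>" using bij_betw_swap[of B m X] \<omega> by (auto simp: bij_betw_def \<Omega>_def)
      moreover have "real (hits R (fst (swap B \<omega>))) + real (hits R (snd (swap B \<omega>))) = real (card (hit_positions (N @ N') R))" for R
        using hits_swap[OF N(2,3), of R B] by (simp add: N(1) card_hit_positions hits_append flip: of_nat_add)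
      ultimately show ?thesis
        using discrepancy_hit_positions[OF N(2,3), of B]
        by (simp add: E_def \<Omega>_def deviating_pairs_def case_prod_unfold mem_Times_iff N(1))
    qed
    then have eq: "{B \<in> Pow {..<m}. swap B \<omega> \<in> E}
       = {B \<in> Pow {..<m}. \<exists>T\<in>hit_positions (N @ N') ` F. \<epsilon> * (card T / 2 + p * m) < \<bar>discrepancy m B T\<bar>}" by simp
    have shattered: "card B \<le> d" if "B \<subseteq> {..<2 * m}" "shatters (hit_positions (N @ N') ` F) B" for B
      by (rule card_shattered_hit_positions_le[where F = F and P = P and W = "N @ N'"])
        (use VC W that in auto)
    have sub: "hit_positions (N @ N') ` F \<subseteq> Pow {..<2 * m}" using W(2) by (auto simp: hit_positions_def)
    show ?thesis
      unfolding eq by (rule card_large_discrepancy_le[OF m sub shattered p \<epsilon> \<delta> size])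
  qed
  have card_E: "card E = card {\<omega> \<in> \<Omega>. swap B \<omega> \<in> E}" for B
  proof -
    have swap: "inj_on (swap B) \<Omega>" "swap B ` \<Omega> = \<Omega>"
      using bij_betw_swap[of B m X] unfolding \<Omega>_def[symmetric] by (auto simp: bij_betw_def)
    have "swap B ` {\<omega> \<in> \<Omega>. swap B \<omega> \<in> E} = swap B ` \<Omega> \<inter> E" by blast
    also have "\<dots> = E" using swap(2) E by blast
    finally have "bij_betw (swap B) {\<omega> \<in> \<Omega>. swap B \<omega> \<in> E} E"
      using swap(1) by (auto simp: bij_betw_def intro: inj_on_subset)
    then show ?thesis by (simp add: bij_betw_same_card)
  qed
  have "2 ^ m * card E = (\<Sum>B\<in>Pow {..<m}. card E)"
    by (simp add: card_Pow)
  also have "\<dots> = (\<Sum>B\<in>Pow {..<m}. card {\<omega> \<in> \<Omega>. swap B \<omega> \<in> E})"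
    by (rule sum.cong[OF refl card_E])
  also have "\<dots> = (\<Sum>\<omega>\<in>\<Omega>. card {B \<in> Pow {..<m}. swap B \<omega> \<in> E})"
    using f\<Omega> by (intro sum_multicount_gen) auto
  finally have double_count: "2 ^ m * card E = (\<Sum>\<omega>\<in>\<Omega>. card {B \<in> Pow {..<m}. swap B \<omega> \<in> E})" .
  have "2 ^ m * real (card E) = real (2 ^ m * card E)" by simp
  also have "\<dots> = (\<Sum>\<omega>\<in>\<Omega>. real (card {B \<in> Pow {..<m}. swap B \<omega> \<in> E}))"
    unfolding double_count by (rule of_nat_sum)
  also have "\<dots> \<le> card \<Omega> * (2 ^ m * (\<delta> / 2))" using swaps by (rule sum_bounded_above)
  finally have "2 ^ m * real (card E) \<le> 2 ^ m * (card \<Omega> * (\<delta> / 2))" by (simp only: mult_ac)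
  then have "real (card E) \<le> card \<Omega> * (\<delta> / 2)" by simp
  then show ?thesis by (simp add: E_def \<Omega>_def card_cartesian_product power2_eq_square)
qed

section \<open>From deviating pairs to relative approximations\<close>

lemma relative_approximationI:
  fixes p \<epsilon> :: real
  assumes "\<epsilon> \<ge> 0"
    and "\<And>R. R \<in> F \<Longrightarrow> \<bar>sample_measure N R - range_measure X R\<bar> \<le> \<epsilon> * max (range_measure X R) p"
  shows "relative_approximation F X p \<epsilon> N"
  unfolding relative_approximation_def
proof (intro ballI conjI impI)
  fix R assume R: "R \<in> F"
  note le = assms(2)[OF R]
  {
    assume "range_measure X R \<ge> p"
    then have "max (range_measure X R) p = range_measure X R" by simp
    then show "(1 - \<epsilon>) * range_measure X R \<le> sample_measure N R"
      "sample_measure N R \<le> (1 + \<epsilon>) * range_measure X R"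
      using le by (auto simp: algebra_simps)
  next
    assume *: "range_measure X R \<le> p"
    then have "max (range_measure X R) p = p" by simp
    then show "sample_measure N R \<le> (1 + \<epsilon>) * p"
      using le * by (auto simp: algebra_simps)
  }
qed

lemma deviating_pair:
  fixes \<epsilon> x y r c M :: real
  assumes \<epsilon>: "0 < \<epsilon>" "\<epsilon> \<le> 1" and x: "\<epsilon> * M < \<bar>x - r\<bar>" and y: "\<bar>y - r\<bar> \<le> \<epsilon> / 4 * M"
    and M: "M > 0" "r \<le> M" "c \<le> M"
  shows "\<epsilon> / 12 * ((x + y) / 2 + c) < \<bar>x - y\<bar>"
proof -
  have xy: "3 / 4 * (\<epsilon> * M) < \<bar>x - y\<bar>" using x y by linarith
  have "\<epsilon> * M \<le> M" using \<epsilon> M by simp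
  then have "y \<le> 5 / 4 * M" using y M by linarith
  \<comment> \<open>No upper bound on \<open>x\<close> is available, so
    \<open>x \<le> y + \<bar>x - y\<bar>\<close> moves its excess into the difference, where the
    factor \<open>\<epsilon> / 24\<close> makes it harmless.\<close>
  then have "(x + y) / 2 + c \<le> \<bar>x - y\<bar> / 2 + 9 / 4 * M" using M abs_ge_self[of "x - y"] by argo
  then have "\<epsilon> / 12 * ((x + y) / 2 + c) \<le> \<epsilon> / 12 * (\<bar>x - y\<bar> / 2 + 9 / 4 * M)"
    using \<epsilon> by (intro mult_left_mono) auto
  also have "\<dots> = \<epsilon> * \<bar>x - y\<bar> / 24 + 3 / 16 * (\<epsilon> * M)" by (simp add: algebra_simps)
  also have "\<dots> < \<bar>x - y\<bar>"
  proof -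
    have "\<epsilon> * \<bar>x - y\<bar> \<le> \<bar>x - y\<bar>" using \<epsilon> by (simp add: mult_left_le_one_le)
    moreover have "\<epsilon> * M > 0" using \<epsilon> M by simp
    ultimately show ?thesis using xy by linarith
  qed
  finally show ?thesis .
qed

text \<open>At least half of all samples are ghosts that form a deviating pair with a given bad
  sample. Hence the proportion of bad samples is at most twice that of deviating pairs. Passing to
  \<open>\<epsilon> / 12\<close> costs the factor \<open>144 = 12\<^sup>2\<close> in the
  size.\<close>

lemma card_not_relative_approximation_le:
  fixes p \<epsilon> \<delta> :: real
  assumes X: "finite X" "X \<noteq> {}" "X \<subseteq> P"
    and VC: "\<And>A. finite A \<Longrightarrow> A \<subseteq> P \<Longrightarrow> shatters F A \<Longrightarrow> card A \<le> d"
    and p: "0 < p" and \<epsilon>: "0 < \<epsilon>" "\<epsilon> \<le> 1" and \<delta>: "0 < \<delta>"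
    and size: "\<epsilon>\<^sup>2 * p * m \<ge> 2 ^ 17 * 144 * (44 * real d * O_log (1 / p) + 65 * O_log (1 / \<delta>))"
  shows "card {N \<in> samples m X. \<not> relative_approximation F X p \<epsilon> N} \<le> \<delta> * card (samples m X)"
proof -
  define bad where "bad = {N \<in> samples m X. \<not> relative_approximation F X p \<epsilon> N}"
  define E where "E = deviating_pairs F X m p (\<epsilon> / 12)"
  have pos: "44 * real d * O_log (1 / p) \<ge> 0" using O_log_ge(1)[of "1 / p"] by simp
  have l: "O_log (1 / \<delta>) \<ge> 1" by (rule O_log_ge)
  have "2 ^ 17 * 144 * 1 \<le> 2 ^ 17 * 144 * (44 * real d * O_log (1 / p) + 65 * O_log (1 / \<delta>))"
    using pos l by (intro mult_left_mono) auto
  also note size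
  finally have size32: "\<epsilon>\<^sup>2 * p * m \<ge> 32" by simp
  then have m: "m > 0" by (intro Nat.gr0I) auto
  have ghosts: "card (samples m X) / 2 \<le> card (E `` {N})" if N: "N \<in> bad" for N
  proof -
    obtain R where R: "R \<in> F" and far: "\<epsilon> * max (range_measure X R) p < \<bar>sample_measure N R - range_measure X R\<bar>"
      using N relative_approximationI[of \<epsilon> F N X p] \<epsilon> unfolding bad_def by force
    define r where "r = range_measure X R"
    have NS: "N \<in> samples m X" and lenN: "length N = m" using N by (auto simp: bad_def samples_def)
    have far': "\<epsilon> * (m * max r p) < \<bar>hits R N - m * r\<bar>"
    proof -
      have "m * (\<epsilon> * max r p) < m * \<bar>hits R N / m - r\<bar>"
        using far m by (simp add: r_def sample_measure_eq_hits lenN)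
      also have "\<dots> = \<bar>m * (hits R N / m - r)\<bar>" by (simp add: abs_mult)
      also have "\<dots> = \<bar>hits R N - m * r\<bar>" using m by (simp add: right_diff_distrib)
      finally show ?thesis by (simp add: mult_ac)
    qed
    have "N' \<in> E `` {N}" if N': "N' \<in> samples m X" "\<bar>hits R N' - m * r\<bar> \<le> m * (\<epsilon> / 4 * max r p)" for N'
    proof -
      have "\<epsilon> / 12 * ((real (hits R N) + real (hits R N')) / 2 + p * m) < \<bar>real (hits R N) - real (hits R N')\<bar>"
      proof (rule deviating_pair[OF \<epsilon> far'])
        show "m * max r p > 0" using m p by (simp add: less_max_iff_disj)
      qed (use N'(2) m in \<open>auto simp: mult_ac\<close>)
      then show ?thesis using NS N'(1) R by (auto simp: E_def deviating_pairs_def)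
    qed
    then have "card {N' \<in> samples m X. \<bar>hits R N' - m * r\<bar> \<le> m * (\<epsilon> / 4 * max r p)} \<le> card (E `` {N})"
      using X by (intro card_mono) (auto simp: E_def deviating_pairs_def intro: finite_subset[of _ "samples m X"])
    then show ?thesis
      using card_ghost_samples_ge[OF X(1,2) p \<epsilon>(1) size32 r_def] by linarith
  qed
  have fE: "finite E"
    using X by (auto simp: E_def deviating_pairs_def intro: finite_subset[of _ "samples m X \<times> samples m X"])
  have fbad: "finite bad" using X by (simp add: bad_def)
  have "card bad * (card (samples m X) / 2) \<le> (\<Sum>N\<in>bad. real (card (E `` {N})))"
    using ghosts by (rule sum_bounded_below)
  also have "\<dots> = card (SIGMA N:bad. E `` {N})"
    using fbad fE by (subst card_SigmaI) (auto intro: finite_Image)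
  also have "\<dots> \<le> card E" using fE by (simp, intro card_mono) auto
  also have "\<dots> \<le> (card (samples m X))\<^sup>2 * (\<delta> / 2)"
    unfolding E_def
  proof (rule card_deviating_pairs_le[OF X(1,3) m VC p _ \<delta>])
    show "(\<epsilon> / 12)\<^sup>2 * p * m \<ge> 2 ^ 17 * (44 * real d * O_log (1 / p) + 65 * O_log (1 / \<delta>))"
      using size by (simp add: power_divide)
  qed (use \<epsilon> in auto)
  finally have "card bad * (card (samples m X) / 2) \<le> (\<delta> * card (samples m X)) * (card (samples m X) / 2)"
    by (simp add: power2_eq_square mult_ac)
  moreover have "real (card (samples m X)) > 0"
    using samples_nonempty[OF X(1,2)] X(1) by (simp add: card_gt_0_iff)
  ultimately show ?thesis by (simp add: bad_def)
qed

theorem theorem5p2: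
  "\<exists>C::real. C > 0 \<and>
     (\<forall>(P :: 'a set) (F :: 'a set set) (d :: nat) (X :: 'a set)
        (\<epsilon> :: real) (p :: real) (\<delta> :: real) (m :: nat).
        range_space P F \<longrightarrow> has_VC_dimension P F d \<longrightarrow>
        finite X \<longrightarrow> X \<noteq> {} \<longrightarrow> X \<subseteq> P \<longrightarrow>
        0 < \<epsilon> \<longrightarrow> \<epsilon> \<le> 1 \<longrightarrow> 0 < p \<longrightarrow> 0 < \<delta> \<longrightarrow>
        real m \<ge> C * (1 / (\<epsilon>\<^sup>2 * p) * (real d * O_log (1 / p) + O_log (1 / \<delta>))) \<longrightarrow>
        measure_pmf.prob (replicate_pmf m (pmf_of_set X))
          {N. relative_approximation F X p \<epsilon> N} \<ge> 1 - \<delta>)"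
\<comment> \<open>The factors come from chaining, from symmetrization, and from 65 as the larger of
  the coefficients 44 and 65.\<close>
proof (intro exI[of _ "2 ^ 17 * 144 * 65"] conjI allI impI)
  fix P :: "'a set" and F :: "'a set set" and d m :: nat and X :: "'a set" and \<epsilon> p \<delta> :: real
  assume "has_VC_dimension P F d"
    and X: "finite X" "X \<noteq> {}" "X \<subseteq> P" and \<epsilon>: "0 < \<epsilon>" "\<epsilon> \<le> 1" and p: "0 < p" and \<delta>: "0 < \<delta>"
    and size: "2 ^ 17 * 144 * 65 * (1 / (\<epsilon>\<^sup>2 * p) * (real d * O_log (1 / p) + O_log (1 / \<delta>))) \<le> real m"
  then have VC: "\<And>A. finite A \<Longrightarrow> A \<subseteq> P \<Longrightarrow> shatters F A \<Longrightarrow> card A \<le> d"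
    by (simp add: has_VC_dimension_def)
  let ?S = "samples m X" and ?bad = "{N \<in> samples m X. \<not> relative_approximation F X p \<epsilon> N}"
  have "2 ^ 17 * 144 * (65 * (d * O_log (1 / p)) + 65 * O_log (1 / \<delta>)) \<le> \<epsilon>\<^sup>2 * p * m"
    using size \<epsilon> p by (simp add: field_simps)
  moreover have "44 * (d * O_log (1 / p)) \<le> 65 * (d * O_log (1 / p))"
    using O_log_ge(1)[of "1 / p"] by (intro mult_right_mono) auto
  ultimately have "2 ^ 17 * 144 * (44 * real d * O_log (1 / p) + 65 * O_log (1 / \<delta>)) \<le> \<epsilon>\<^sup>2 * p * m"
    by (simp add: mult.assoc)
  then have bad: "card ?bad \<le> \<delta> * card ?S"
    using card_not_relative_approximation_le[OF X VC p \<epsilon> \<delta>, where m = m] by blast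
  have S: "?S \<noteq> {}" "finite ?S" using samples_nonempty[OF X(1,2)] X(1) by auto
  then have S0: "real (card ?S) > 0" by (simp add: card_gt_0_iff)
  have "card (?S \<inter> {N. relative_approximation F X p \<epsilon> N}) = real (card ?S) - card ?bad"
  proof -
    have "card ?S = card (?S \<inter> {N. relative_approximation F X p \<epsilon> N}) + card ?bad"
      using S(2) by (subst card_Un_disjoint[symmetric]) (auto intro: arg_cong[of _ _ card])
    then show ?thesis by linarith
  qed
  then show "measure_pmf.prob (replicate_pmf m (pmf_of_set X)) {N. relative_approximation F X p \<epsilon> N} \<ge> 1 - \<delta>"
    using bad S0
    by (simp add: replicate_pmf_of_set[OF X(1,2)] measure_pmf_of_set[OF S] field_simps)
qed simp

end
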